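(* Let $k=\mathbb{Q}$ or $k=\mathbb{Q}_p$ ($p$ a prime), and let $G$ be a split group of type $G_2$ over $k$. Then there exists a semisimple element in $G(k)$ which is not conjugate to its inverse in $G(k)$.
   Context: The split group of type $G_2$ over $k$ is $\mathrm{Aut}(\mathfrak C)$ where $\mathfrak C$ is the split octonion algebra over $k$ (the octonion algebra, i.e. $8$-dimensional unital algebra with nondegenerate multiplicative quadratic form $N$, whose norm $N$ is hyperbolic). *)

theory Defs
  imports
    "HOL-Algebra.Algebraic_Closure_Type"
    "HOL-Computational_Algebra.Fraction_Field"
    "HOL-Library.Product_Plus"
    "Jordan_Normal_Form.Matrix"
    "Berlekamp_Zassenhaus.Finite_Field"
begin

section \<open>The field of p-adic numbers\<close>

text \<open>
  The prime is \<open>p = CARD('p)\<close>. A p-adic integer is an element of the inverse limit of the rings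
  \<open>\<int>/p\<^sup>n\<int>\<close>, the \<open>n\<close>-th component being represented by its residue in \<open>{0..<p\<^sup>n}\<close>
  (membership in this range is a consequence of the compatibility condition).
\<close>

typedef (overloaded) 'p padic_int =
  "{f :: nat \<Rightarrow> int. \<forall>n. f (Suc n) mod int CARD('p::prime_card) ^ n = f n}"
  by (rule exI[of _ "\<lambda>_. 0"]) simp

setup_lifting type_definition_padic_int

lemma CARD_prime_card_gt_1: "CARD('p::prime_card) > 1"
  using prime_card[where 'a = 'p] prime_gt_1_nat by blast

lemma mod_power_Suc_mod: "(a mod p ^ Suc n) mod p ^ n = a mod (p ^ n :: int)"
  by (rule mod_mod_cancel) (simp add: le_imp_power_dvd)

lemma compatible_imp_reduced:
  assumes "\<forall>n. f (Suc n) mod p ^ n = (f n :: int)"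
  shows "f n mod p ^ n = f n"
proof -
  have a: "f (Suc n) mod p ^ n = f n" using assms by blast
  have "f (Suc n) mod p ^ n mod p ^ n = f (Suc n) mod p ^ n" by (rule mod_mod_trivial)
  then show ?thesis unfolding a .
qed

instantiation padic_int :: (prime_card) comm_ring_1
begin

lift_definition zero_padic_int :: "'a padic_int" is "\<lambda>_. 0" by simp

lift_definition one_padic_int :: "'a padic_int" is "\<lambda>n. 1 mod int CARD('a) ^ n"
  by (simp only: mod_power_Suc_mod simp_thms)

lift_definition plus_padic_int :: "'a padic_int \<Rightarrow> 'a padic_int \<Rightarrow> 'a padic_int"
  is "\<lambda>f g n. (f n + g n) mod int CARD('a) ^ n"
  by (metis mod_power_Suc_mod mod_add_eq)

lift_definition minus_padic_int :: "'a padic_int \<Rightarrow> 'a padic_int \<Rightarrow> 'a padic_int"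
  is "\<lambda>f g n. (f n - g n) mod int CARD('a) ^ n"
  by (metis mod_power_Suc_mod mod_diff_eq)

lift_definition uminus_padic_int :: "'a padic_int \<Rightarrow> 'a padic_int"
  is "\<lambda>f n. (- f n) mod int CARD('a) ^ n"
  by (metis mod_power_Suc_mod mod_minus_eq)

lift_definition times_padic_int :: "'a padic_int \<Rightarrow> 'a padic_int \<Rightarrow> 'a padic_int"
  is "\<lambda>f g n. (f n * g n) mod int CARD('a) ^ n"
  by (metis mod_power_Suc_mod mod_mult_eq)

instance
proof
  fix a b c :: "'a padic_int"
  show "a + b + c = a + (b + c)"
    by transfer (simp only: mod_add_left_eq mod_add_right_eq add.assoc)
  show "a + b = b + a"
    by transfer (simp only: add.commute)
  show "0 + a = a"
    by transfer (intro ext, simp only: add_0_left, erule compatible_imp_reduced)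
  show "- a + a = 0"
    by transfer (simp only: mod_add_left_eq left_minus mod_0)
  show "a - b = a + - b"
    by transfer (simp only: mod_add_right_eq diff_conv_add_uminus)
  show "a * b * c = a * (b * c)"
    by transfer (simp only: mod_mult_left_eq mod_mult_right_eq mult.assoc)
  show "a * b = b * a"
    by transfer (simp only: mult.commute)
  show "1 * a = a"
    by transfer (intro ext, simp only: mod_mult_left_eq mult_1_left, erule compatible_imp_reduced)
  show "(a + b) * c = a * c + b * c"
    by transfer (simp only: mod_mult_left_eq mod_add_eq distrib_right)
  show "(0 :: 'a padic_int) \<noteq> 1"
  proof (transfer, rule notI)
    assume "(\<lambda>_. 0) = (\<lambda>n. 1 mod int CARD('a) ^ n)"
    from fun_cong[OF this, of 1] show False
      using CARD_prime_card_gt_1[where 'p = 'a] by simp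
  qed
qed

end

lemma padic_int_component_dvd:
  assumes "\<forall>n. f (Suc n) mod p ^ n = (f n :: int)"
  shows "p ^ m dvd f (m + k) - f m"
proof (induction k)
  case (Suc k)
  have "f (m + k) = f (Suc (m + k)) mod p ^ (m + k)"
    using assms by simp
  then have "p ^ (m + k) dvd f (Suc (m + k)) - f (m + k)"
    by (metis minus_mod_eq_mult_div dvd_triv_left)
  then have "p ^ m dvd f (Suc (m + k)) - f (m + k)"
    by (meson dvd_trans le_imp_power_dvd le_add1)
  with Suc.IH have "p ^ m dvd (f (Suc (m + k)) - f (m + k)) + (f (m + k) - f m)"
    by (intro dvd_add)
  then show ?case by simp
qed simp

instance padic_int :: (prime_card) idom
proof
  fix a b :: "'a padic_int"
  have "a \<noteq> 0 \<longrightarrow> b \<noteq> 0 \<longrightarrow> a * b \<noteq> 0"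
  proof (transfer, intro impI notI)
    fix f g :: "nat \<Rightarrow> int"
    define p where "p = int CARD('a)"
    assume f: "\<forall>n. f (Suc n) mod int CARD('a) ^ n = f n" "f \<noteq> (\<lambda>_. 0)"
      and g: "\<forall>n. g (Suc n) mod int CARD('a) ^ n = g n" "g \<noteq> (\<lambda>_. 0)"
      and fg: "(\<lambda>n. f n * g n mod int CARD('a) ^ n) = (\<lambda>_. 0)"
    note fp = f(1)[folded p_def] and gp = g(1)[folded p_def]
    obtain m k where mk: "f m \<noteq> 0" "g k \<noteq> 0" using f(2) g(2) by blast
    have p: "prime p" unfolding p_def by (rule prime_card_int)
    have ndvd: "\<not> p ^ n dvd h (n + l)" if h: "\<forall>n. h (Suc n) mod p ^ n = h n" "h n \<noteq> 0" for h n l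
    proof
      assume "p ^ n dvd h (n + l)"
      from dvd_diff[OF this padic_int_component_dvd[OF h(1), of n l]] have "p ^ n dvd h n" by simp
      then show False
        using compatible_imp_reduced[OF h(1), of n] h(2) by (simp add: dvd_eq_mod_eq_0)
    qed
    have nf: "\<not> p ^ m dvd f (m + k)" by (rule ndvd[OF fp mk(1)])
    have ng: "\<not> p ^ k dvd g (m + k)"
      using ndvd[OF gp mk(2), of m] by (simp add: add.commute)
    have nz: "f (m + k) \<noteq> 0" "g (m + k) \<noteq> 0" using nf ng by auto
    have "multiplicity p (f (m + k)) < m" "multiplicity p (g (m + k)) < k"
      using nf ng by (meson multiplicity_dvd' not_less)+
    then have "multiplicity p (f (m + k) * g (m + k)) < m + k"
      using nz by (simp add: prime_elem_multiplicity_mult_distrib[OF prime_imp_prime_elem[OF p]])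
    moreover have "p ^ (m + k) dvd f (m + k) * g (m + k)"
      using fun_cong[OF fg, of "m + k"] by (simp add: p_def dvd_eq_mod_eq_0)
    then have "m + k \<le> multiplicity p (f (m + k) * g (m + k))"
      using nz not_prime_unit[of p] p by (intro multiplicity_geI) auto
    ultimately show False by simp
  qed
  then show "a \<noteq> 0 \<Longrightarrow> b \<noteq> 0 \<Longrightarrow> a * b \<noteq> 0" by blast
qed

type_synonym 'p padic = "'p padic_int fract"


section \<open>Split octonion algebras\<close>

definition polar :: "('v::ab_group_add \<Rightarrow> 'k::field) \<Rightarrow> 'v \<Rightarrow> 'v \<Rightarrow> 'k" where
  "polar N x y = N (x + y) - N x - N y"

text \<open>
  Linearity of the polar form in its first argument suffices, since it is symmetric.
\<close>

definition nondegenerate_quadratic_form ::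
  "('k::field \<Rightarrow> 'v::ab_group_add \<Rightarrow> 'v) \<Rightarrow> ('v \<Rightarrow> 'k) \<Rightarrow> bool" where
  "nondegenerate_quadratic_form scale N \<longleftrightarrow>
     (\<forall>a x. N (scale a x) = a\<^sup>2 * N x) \<and>
     (\<forall>x y z. polar N (x + y) z = polar N x z + polar N y z) \<and>
     (\<forall>a x y. polar N (scale a x) y = a * polar N x y) \<and>
     (\<forall>x. (\<forall>y. polar N x y = 0) \<longrightarrow> x = 0)"

text \<open>
  An orthogonal sum of hyperbolic planes: in coordinates with respect to a basis
  \<open>e\<^sub>0, \<dots>, e\<^sub>n\<^sub>-\<^sub>1, f\<^sub>0, \<dots>, f\<^sub>n\<^sub>-\<^sub>1\<close> the form is \<open>\<Sum> x\<^sub>i y\<^sub>i\<close>. Linear independence of this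
  family need not be required, as it follows from the nondegeneracy of \<open>\<Sum> x\<^sub>i y\<^sub>i\<close>.
\<close>

definition hyperbolic_form ::
  "('k::field \<Rightarrow> 'v::ab_group_add \<Rightarrow> 'v) \<Rightarrow> ('v \<Rightarrow> 'k) \<Rightarrow> bool" where
  "hyperbolic_form scale N \<longleftrightarrow>
     (\<exists>(n::nat) e f. module.span scale (e ` {..<n} \<union> f ` {..<n}) = UNIV \<and>
        (\<forall>x y. N (\<Sum>i<n. scale (x i) (e i) + scale (y i) (f i)) = (\<Sum>i<n. x i * y i)))"

locale octonion_algebra = vector_space scale
  for scale :: "'k::field \<Rightarrow> 'c::ab_group_add \<Rightarrow> 'c" +
  fixes mul :: "'c \<Rightarrow> 'c \<Rightarrow> 'c" and unit :: 'c and N :: "'c \<Rightarrow> 'k"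
  assumes dim_8: "dim UNIV = 8"
    and mul_add_left: "mul (x + y) z = mul x z + mul y z"
    and mul_add_right: "mul x (y + z) = mul x y + mul x z"
    and mul_scale_left: "mul (scale a x) y = scale a (mul x y)"
    and mul_scale_right: "mul x (scale a y) = scale a (mul x y)"
    and unit_left: "mul unit x = x"
    and unit_right: "mul x unit = x"
    and nondegenerate: "nondegenerate_quadratic_form scale N"
    and multiplicative: "N (mul x y) = N x * N y"

locale split_octonion_algebra = octonion_algebra +
  assumes hyperbolic: "hyperbolic_form scale N"

text \<open>
  For a split octonion algebra over \<open>k\<close>, the following is the group \<open>G(k)\<close> of rational points of
  the split group \<open>G\<close> of type \<open>G\<^sub>2\<close>.
\<close>

definition algebra_aut_group ::
  "('k::field \<Rightarrow> 'c::ab_group_add \<Rightarrow> 'c) \<Rightarrow> ('c \<Rightarrow> 'c \<Rightarrow> 'c) \<Rightarrow> 'c \<Rightarrow> ('c \<Rightarrow> 'c) monoid" where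
  "algebra_aut_group scale mul unit =
     \<lparr>carrier = {g. Vector_Spaces.linear scale scale g \<and> bij g \<and>
                    (\<forall>x y. g (mul x y) = mul (g x) (g y)) \<and> g unit = unit},
      monoid.mult = (\<circ>), one = id\<rparr>"

lemma (in vector_space) group_algebra_aut_group: "group (algebra_aut_group scale mul unit)"
proof (rule groupI)
  fix g assume g: "g \<in> carrier (algebra_aut_group scale mul unit)"
  then have lin: "Vector_Spaces.linear scale scale g" and b: "bij g"
    and hom: "\<And>x y. g (mul x y) = mul (g x) (g y)" "g unit = unit"
    by (auto simp: algebra_aut_group_def)
  have gi: "g (inv_into UNIV g x) = x" for x by (meson b bij_inv_eq_iff)
  have ig: "inv_into UNIV g (g x) = x" for x using b by (simp add: bij_is_inj)
  interpret g: Vector_Spaces.linear scale scale g by (rule lin)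
  have "Vector_Spaces.linear scale scale (inv_into UNIV g)"
  proof (unfold_locales)
    show "inv_into UNIV g (x + y) = inv_into UNIV g x + inv_into UNIV g y" for x y
      by (metis gi ig g.add)
    show "inv_into UNIV g (scale a x) = scale a (inv_into UNIV g x)" for a x
      by (metis gi ig g.scale)
  qed
  moreover have "bij (inv_into UNIV g)" by (simp add: b bij_imp_bij_inv)
  moreover have "inv_into UNIV g (mul x y) = mul (inv_into UNIV g x) (inv_into UNIV g y)" for x y
    by (metis gi ig hom(1))
  moreover have "inv_into UNIV g unit = unit" by (metis ig hom(2))
  ultimately show "\<exists>h\<in>carrier (algebra_aut_group scale mul unit).
      h \<otimes>\<^bsub>algebra_aut_group scale mul unit\<^esub> g = \<one>\<^bsub>algebra_aut_group scale mul unit\<^esub>"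
    by (intro bexI[of _ "inv_into UNIV g"]) (auto simp: algebra_aut_group_def ig)
qed (auto simp: algebra_aut_group_def comp_assoc bij_comp linear_id[unfolded id_def]
        linear_id intro: Vector_Spaces.linear_compose)

definition conjugate_in :: "('g, 'b) monoid_scheme \<Rightarrow> 'g \<Rightarrow> 'g \<Rightarrow> bool" where
  "conjugate_in G x y \<longleftrightarrow> (\<exists>h\<in>carrier G. h \<otimes>\<^bsub>G\<^esub> x \<otimes>\<^bsub>G\<^esub> inv\<^bsub>G\<^esub> h = y)"


section \<open>Semisimple elements\<close>

definition basis_list :: "('k::field \<Rightarrow> 'v::ab_group_add \<Rightarrow> 'v) \<Rightarrow> 'v list \<Rightarrow> bool" where
  "basis_list scale bs \<longleftrightarrow>
     distinct bs \<and> \<not> module.dependent scale (set bs) \<and> module.span scale (set bs) = UNIV"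

definition endo_mat ::
  "('k::field \<Rightarrow> 'v::ab_group_add \<Rightarrow> 'v) \<Rightarrow> 'v list \<Rightarrow> ('v \<Rightarrow> 'v) \<Rightarrow> 'k mat" where
  "endo_mat scale bs g =
     mat (length bs) (length bs)
       (\<lambda>(i, j). module.representation scale (set bs) (g (bs ! j)) (bs ! i))"

text \<open>
  An element of a linear algebraic group over \<open>k\<close> is semisimple if it is diagonalizable over an
  algebraic closure of \<open>k\<close> in a faithful representation. For the automorphism group of an algebra
  we use the defining representation.
\<close>

definition semisimple :: "('k::field \<Rightarrow> 'v::ab_group_add \<Rightarrow> 'v) \<Rightarrow> ('v \<Rightarrow> 'v) \<Rightarrow> bool" where
  "semisimple scale g \<longleftrightarrow>
     (\<exists>bs D. basis_list scale bs \<and> diagonal_mat D \<and>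
        similar_mat (map_mat to_ac (endo_mat scale bs g)) D)"


section \<open>Zorn's vector matrices: existence of split octonion algebras\<close>

text \<open>
  The tuple \<open>(a, b, v1, v2, v3, w1, w2, w3)\<close> stands for the vector matrix with diagonal entries
  \<open>a\<close>, \<open>b\<close> and off-diagonal entries \<open>v\<close>, \<open>w\<close>.
\<close>

type_synonym 'k zorn = "'k \<times> 'k \<times> 'k \<times> 'k \<times> 'k \<times> 'k \<times> 'k \<times> 'k"

lemma zorn_cases: obtains (fields) a b c d e f g h where "(x::'k zorn) = (a,b,c,d,e,f,g,h)"
  by (metis prod.exhaust)

fun zorn_scale :: "'k::field \<Rightarrow> 'k zorn \<Rightarrow> 'k zorn" where
 "zorn_scale c (a,b,v1,v2,v3,w1,w2,w3) = (c*a,c*b,c*v1,c*v2,c*v3,c*w1,c*w2,c*w3)"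
fun zorn_mul :: "'k::field zorn \<Rightarrow> 'k zorn \<Rightarrow> 'k zorn" where
 "zorn_mul (a,b,v1,v2,v3,w1,w2,w3) (a',b',v1',v2',v3',w1',w2',w3') =
  (a*a' + v1*w1'+v2*w2'+v3*w3', b*b'+w1*v1'+w2*v2'+w3*v3',
   a*v1'+b'*v1 - (w2*w3'-w3*w2'), a*v2'+b'*v2 - (w3*w1'-w1*w3'), a*v3'+b'*v3 - (w1*w2'-w2*w1'),
   a'*w1+b*w1' + (v2*v3'-v3*v2'), a'*w2+b*w2' + (v3*v1'-v1*v3'), a'*w3+b*w3' + (v1*v2'-v2*v1'))"
fun zorn_norm :: "'k::field zorn \<Rightarrow> 'k" where
 "zorn_norm (a,b,v1,v2,v3,w1,w2,w3) = a*b - v1*w1 - v2*w2 - v3*w3"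
definition zorn_e :: "nat \<Rightarrow> 'k::field zorn" where
 "zorn_e i = (if i = 0 then (1,0,0,0,0,0,0,0) else if i = 1 then (0,0,1,0,0,0,0,0)
   else if i = 2 then (0,0,0,1,0,0,0,0) else (0,0,0,0,1,0,0,0))"
definition zorn_f :: "nat \<Rightarrow> 'k::field zorn" where
 "zorn_f i = (if i = 0 then (0,1,0,0,0,0,0,0) else if i = 1 then (0,0,0,0,0,-1,0,0)
   else if i = 2 then (0,0,0,0,0,0,-1,0) else (0,0,0,0,0,0,0,-1))"

lemma vector_space_zorn: "vector_space (zorn_scale :: 'k::field \<Rightarrow> _)"
  by standard (auto simp: algebra_simps)

lemma zorn_sum: "(\<Sum>i<4. zorn_scale (x i) (zorn_e i) + zorn_scale (y i) (zorn_f i)) =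
   (x 0, y 0, x 1, x 2, x 3, - y 1, - y 2, - y (3::nat))"
  by (simp add: zorn_e_def zorn_f_def eval_nat_numeral)

lemma image_lessThan_4: "f ` {..<4::nat} = {f 0, f 1, f 2, f 3}"
  by (simp add: eval_nat_numeral lessThan_Suc insert_commute)

lemma zorn_span: "module.span (zorn_scale :: 'k::field \<Rightarrow> _) (zorn_e ` {..<4::nat} \<union> zorn_f ` {..<4::nat}) = UNIV"
proof -
  interpret vector_space "zorn_scale :: 'k \<Rightarrow> _" by (rule vector_space_zorn)
  have "v \<in> span (zorn_e ` {..<4::nat} \<union> zorn_f ` {..<4::nat})" for v :: "'k zorn"
  proof (cases v rule: zorn_cases)
    case (fields a b c d e f g h)
    define x where "x = (\<lambda>i::nat. if i = 0 then a else if i = 1 then c else if i = 2 then d else e)"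
    define y where "y = (\<lambda>i::nat. if i = 0 then b else if i = 1 then -f else if i = 2 then -g else -h)"
    have "v = (\<Sum>i<4. zorn_scale (x i) (zorn_e i) + zorn_scale (y i) (zorn_f i))"
      by (simp add: zorn_sum fields x_def y_def)
    also have "\<dots> \<in> span (zorn_e ` {..<4::nat} \<union> zorn_f ` {..<4::nat})"
      by (intro span_sum span_add span_scale span_base) auto
    finally show ?thesis .
  qed
  then show ?thesis by blast
qed

lemma zorn_dim: "vector_space.dim (zorn_scale :: 'k::field \<Rightarrow> _) UNIV = 8"
proof -
  interpret vector_space "zorn_scale :: 'k \<Rightarrow> _" by (rule vector_space_zorn)
  let ?B = "zorn_e ` {..<4::nat} \<union> zorn_f ` {..<4::nat} :: 'k zorn set"
  have e: "?B = {zorn_e 0, zorn_e 1, zorn_e 2, zorn_e 3, zorn_f 0, zorn_f 1, zorn_f 2, zorn_f 3}" by (simp add: image_lessThan_4 insert_commute)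
  have fin: "finite ?B" by simp
  have ind: "independent ?B"
    unfolding e
    by (subst dependent_finite, simp, simp add: zorn_e_def zorn_f_def zero_prod_def)
  have "card ?B = 8" unfolding e by (simp add: zorn_e_def zorn_f_def)
  then show ?thesis using dim_eq_card[of ?B UNIV] ind zorn_span by auto
qed

lemma split_octonion_algebra_zorn: "split_octonion_algebra (zorn_scale :: 'k::field \<Rightarrow> _) zorn_mul (1,1,0,0,0,0,0,0) zorn_norm"
proof -
  interpret vector_space "zorn_scale :: 'k \<Rightarrow> _" by (rule vector_space_zorn)
  show ?thesis
  proof
    show "dim (UNIV :: 'k zorn set) = 8" by (rule zorn_dim)
    show "zorn_mul (x + y) z = zorn_mul x z + zorn_mul y z" for x y z :: "'k zorn"
      by (cases x rule: zorn_cases; cases y rule: zorn_cases; cases z rule: zorn_cases) (simp add: algebra_simps)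
    show "zorn_mul x (y + z) = zorn_mul x y + zorn_mul x z" for x y z :: "'k zorn"
      by (cases x rule: zorn_cases; cases y rule: zorn_cases; cases z rule: zorn_cases) (simp add: algebra_simps)
    show "zorn_mul (zorn_scale a x) y = zorn_scale a (zorn_mul x y)" for a and x y :: "'k zorn"
      by (cases x rule: zorn_cases; cases y rule: zorn_cases) (simp add: algebra_simps)
    show "zorn_mul x (zorn_scale a y) = zorn_scale a (zorn_mul x y)" for a and x y :: "'k zorn"
      by (cases x rule: zorn_cases; cases y rule: zorn_cases) (simp add: algebra_simps)
    show "zorn_mul (1,1,0,0,0,0,0,0) x = x" "zorn_mul x (1,1,0,0,0,0,0,0) = x" for x :: "'k zorn"
      by (cases x rule: zorn_cases; simp)+
    show "zorn_norm (zorn_mul x y) = zorn_norm x * zorn_norm y" for x y :: "'k zorn"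
      by (cases x rule: zorn_cases; cases y rule: zorn_cases) (simp add: algebra_simps)
    show "hyperbolic_form zorn_scale (zorn_norm :: 'k zorn \<Rightarrow> _)"
      unfolding hyperbolic_form_def
      by (rule exI[of _ 4], rule exI[of _ zorn_e], rule exI[of _ zorn_f])
        (simp only: zorn_sum zorn_span, simp add: eval_nat_numeral)
    show "nondegenerate_quadratic_form zorn_scale (zorn_norm :: 'k zorn \<Rightarrow> _)"
      unfolding nondegenerate_quadratic_form_def
    proof (intro conjI allI impI)
      show "zorn_norm (zorn_scale a x) = a\<^sup>2 * zorn_norm x" for a and x :: "'k zorn"
        by (cases x rule: zorn_cases) (simp add: algebra_simps power2_eq_square)
      show "polar zorn_norm (x + y) z = polar zorn_norm x z + polar zorn_norm y z" for x y z :: "'k zorn"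
        by (cases x rule: zorn_cases; cases y rule: zorn_cases; cases z rule: zorn_cases) (simp add: polar_def algebra_simps)
      show "polar zorn_norm (zorn_scale a x) y = a * polar zorn_norm x y" for a and x y :: "'k zorn"
        by (cases x rule: zorn_cases; cases y rule: zorn_cases) (simp add: polar_def algebra_simps)
      fix x :: "'k zorn"
      assume *: "\<forall>y. polar zorn_norm x y = 0"
      show "x = 0"
      proof (cases x rule: zorn_cases)
        case (fields a b c d e f g h)
        show ?thesis
          using *[rule_format, of "(1,0,0,0,0,0,0,0)"] *[rule_format, of "(0,1,0,0,0,0,0,0)"]
            *[rule_format, of "(0,0,1,0,0,0,0,0)"] *[rule_format, of "(0,0,0,1,0,0,0,0)"]
            *[rule_format, of "(0,0,0,0,1,0,0,0)"] *[rule_format, of "(0,0,0,0,0,1,0,0)"]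
            *[rule_format, of "(0,0,0,0,0,0,1,0)"] *[rule_format, of "(0,0,0,0,0,0,0,1)"]
          by (simp add: fields polar_def algebra_simps zero_prod_def)
      qed
    qed
  qed
qed

end

theory Submission
  imports Defs "Jordan_Normal_Form.Determinant"
begin

text \<open>
  The octonion algebra is identified with Zorn's vector matrices, on which \<open>SL\<^sub>3\<close> acts by
  \<open>(x, y, v, w) \<mapsto> (x, y, A v, A\<^sup>-\<^sup>T w)\<close>. Take \<open>A\<close> whose characteristic polynomial
  \<open>f = X\<^sup>3 + a X\<^sup>2 + b X - 1\<close> has no root modulo \<open>p\<close>. An automorphism \<open>h\<close> conjugating this element
  to its inverse preserves the fixed space, spanned by the two diagonal idempotents. If it fixes
  the idempotents, then \<open>A\<close> and its inverse are similar, so \<open>f\<close> is reciprocal up to sign, hence has a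
  root \<open>\<plusminus> 1\<close>. If it swaps them, then it gives a matrix \<open>H\<close> of determinant \<open>- 1\<close> with \<open>H A = A\<^sup>T H\<close>.
  In terms of the unramified cubic extension \<open>K = k[X] / f\<close> these \<open>H\<close> are the bilinear forms
  \<open>(x, y) \<mapsto> Tr (c x y)\<close>, whose determinants form a single coset of the norms of \<open>K\<close>
  in \<open>k\<^sup>\<times>\<close>. Norms have valuation divisible by 3, and the lattice basis for \<open>A\<close> is chosen such that
  the determinants of the \<open>H\<close> have valuation congruent to 1. The same argument works over \<open>\<rat>\<close>,
  with the \<open>p\<close>-adic valuation for an arbitrary prime \<open>p\<close>.
\<close>

section \<open>Composition identities\<close>

context octonion_algebra
begin

abbreviation B :: "'c \<Rightarrow> 'c \<Rightarrow> 'k" where "B \<equiv> polar N"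

lemma polar_commute: "B x y = B y x"
  by (simp add: polar_def add.commute)

lemma N_scale: "N (scale a x) = a\<^sup>2 * N x"
  using nondegenerate by (simp add: nondegenerate_quadratic_form_def)

lemma polar_add_left: "B (x + y) z = B x z + B y z"
  using nondegenerate by (simp add: nondegenerate_quadratic_form_def)

lemma polar_scale_left: "B (scale a x) y = a * B x y"
  using nondegenerate by (simp add: nondegenerate_quadratic_form_def)

lemma polar_add_right: "B z (x + y) = B z x + B z y"
  by (simp add: polar_add_left polar_commute[of z])

lemma polar_scale_right: "B y (scale a x) = a * B y x"
  by (simp add: polar_scale_left polar_commute[of y])

lemma polar_minus_left: "B (- x) y = - B x y"
  using polar_scale_left[of "-1" x y] by simp

lemma polar_minus_right: "B y (- x) = - B y x"
  by (simp add: polar_minus_left polar_commute[of y])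

lemma polar_diff_left: "B (x - y) z = B x z - B y z"
  using polar_add_left[of x "- y" z] by (simp add: polar_minus_left)

lemma polar_diff_right: "B z (x - y) = B z x - B z y"
  by (simp add: polar_diff_left polar_commute[of z])

lemma polar_zero_left: "B 0 y = 0"
  using polar_scale_left[of 0 0 y] by simp

lemma polar_zero_right: "B y 0 = 0"
  by (simp add: polar_zero_left polar_commute[of y])

lemmas polar_linear =
  polar_add_left polar_add_right polar_diff_left polar_diff_right polar_minus_left
  polar_minus_right polar_scale_left polar_scale_right polar_zero_left polar_zero_right

lemma polar_eqI: "x = y" if "\<And>z. B x z = B y z"
proof -
  have "\<forall>z. B (x - y) z = 0" using that by (simp add: polar_diff_left)
  then have "x - y = 0"
    using nondegenerate unfolding nondegenerate_quadratic_form_def by blast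
  then show ?thesis by simp
qed

lemma N_add: "N (x + y) = N x + N y + B x y"
  by (simp add: polar_def)

lemma mul_minus_left: "mul (- x) y = - mul x y"
  using mul_scale_left[of "-1" x y] by simp

lemma mul_minus_right: "mul x (- y) = - mul x y"
  using mul_scale_right[of x "-1" y] by simp

lemma mul_diff_left: "mul (x - y) z = mul x z - mul y z"
  using mul_add_left[of x "- y" z] by (simp add: mul_minus_left)

lemma mul_diff_right: "mul z (x - y) = mul z x - mul z y"
  using mul_add_right[of z x "- y"] by (simp add: mul_minus_right)

lemma mul_zero_left: "mul 0 y = 0"
  using mul_scale_left[of 0 0 y] by simp

lemma mul_zero_right: "mul y 0 = 0"
  using mul_scale_right[of y 0 0] by simp

lemmas mul_linear =
  mul_add_left mul_add_right mul_diff_left mul_diff_right mul_minus_left mul_minus_right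
  mul_scale_left mul_scale_right mul_zero_left mul_zero_right unit_left unit_right

text \<open>Multiplicativity gives \<open>N unit * N x = N x\<close>, and some \<open>N x\<close> is
  nonzero: a vanishing norm would be degenerate and force dimension 0.\<close>

lemma N_unit: "N unit = 1"
proof -
  have "\<exists>x. N x \<noteq> 0"
  proof (rule ccontr)
    assume "\<nexists>x. N x \<noteq> 0"
    then have "x = 0" for x :: 'c by (intro polar_eqI) (simp add: polar_def)
    then have "(UNIV :: 'c set) = span {}" by auto
    then have "dim (UNIV :: 'c set) = 0" by (metis card.empty dim_span_eq_card_independent independent_empty)
    then show False using dim_8 by simp
  qed
  then obtain x where "N x \<noteq> 0" by blast
  then show ?thesis using multiplicative[of unit x] by (simp add: unit_left)
qed

lemma polar_mul_left_same: "B (mul x y) (mul x z) = N x * B y z"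
  by (simp add: polar_def multiplicative algebra_simps flip: mul_add_right)

text \<open>Multiplicativity of \<open>N\<close>, linearized in both factors. Setting one argument
  to \<open>unit\<close> yields the adjoints of left and right multiplications.\<close>

lemma polar_mul_mul: "B (mul x y) (mul z w) + B (mul z y) (mul x w) = B x z * B y w"
  using polar_mul_left_same[of "x + z" y w]
  by (simp add: mul_linear polar_linear polar_mul_left_same N_add algebra_simps)

abbreviation tr :: "'c \<Rightarrow> 'k" where "tr x \<equiv> B x unit"

definition bar :: "'c \<Rightarrow> 'c" where "bar x = scale (tr x) unit - x"

lemma tr_unit: "tr unit = 2"
proof -
  have "N (unit + unit) = 4"
    using N_scale[of 2 unit] scale_left_distrib[of 1 1 unit] by (simp add: N_unit)
  then show ?thesis by (simp add: polar_def N_unit)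
qed

lemma bar_bar: "bar (bar x) = x"
  by (simp add: bar_def polar_linear tr_unit algebra_simps)

lemma polar_mul_left: "B (mul x y) z = B y (mul (bar x) z)"
  using polar_mul_mul[of x y unit z]
  by (simp add: bar_def mul_linear polar_linear algebra_simps)

lemma polar_mul_right: "B (mul x y) z = B x (mul z (bar y))"
  using polar_mul_mul[of x y z unit]
  by (simp add: bar_def mul_linear polar_linear polar_commute[of _ "mul _ _"] algebra_simps)

text \<open>Left multiplication by \<open>bar x\<close> is adjoint to left multiplication by
  \<open>x\<close>, which scales the polar form by \<open>N x\<close>; nondegeneracy identifies the
  composite.\<close>

lemma bar_mul_mul: "mul (bar x) (mul x y) = scale (N x) y"
proof (rule polar_eqI)
  fix z
  have "B (mul (bar x) (mul x y)) z = B (mul x y) (mul x z)"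
    by (simp add: polar_mul_left bar_bar)
  then show "B (mul (bar x) (mul x y)) z = B (scale (N x) y) z"
    by (simp add: polar_mul_left_same polar_linear)
qed

lemma N_bar: "N (bar x) = N x"
proof -
  have "N (bar x) + N x + B (bar x) x = (tr x)\<^sup>2"
    using N_add[of "bar x" x] N_scale[of "tr x" unit] by (simp add: bar_def N_unit)
  moreover have "B x x = 2 * N x"
    using N_scale[of 2 x] scale_left_distrib[of 1 1 x] by (simp add: polar_def)
  ultimately show ?thesis
    by (simp add: bar_def polar_linear polar_commute[of unit] power2_eq_square)
qed

lemma mul_mul_bar: "mul (mul y x) (bar x) = scale (N x) y"
proof (rule polar_eqI)
  fix z
  have "B (mul (mul y x) (bar x)) z = B (mul y x) (mul z x)"
    by (simp add: polar_mul_right bar_bar)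
  also have "\<dots> = N x * B y z"
    by (simp add: polar_def multiplicative algebra_simps flip: mul_add_left)
  finally show "B (mul (mul y x) (bar x)) z = B (scale (N x) y) z"
    by (simp add: polar_linear)
qed

section \<open>Quadratic equation and alternative laws\<close>

lemma mul_self: "mul x x = scale (tr x) x - scale (N x) unit"
  using bar_mul_mul[of x unit] by (simp add: bar_def mul_linear algebra_simps)

lemma mul_mul_self: "mul x (mul x y) = mul (mul x x) y"
  using bar_mul_mul[of x y] by (simp add: bar_def mul_self mul_linear algebra_simps)

lemma mul_self_mul: "mul (mul y x) x = mul y (mul x x)"
  using mul_mul_bar[of y x] by (simp add: bar_def mul_self mul_linear algebra_simps)

lemma left_alternative: "mul x (mul z y) + mul z (mul x y) = mul (mul x z + mul z x) y"
  using mul_mul_self[of "x + z" y]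
  by (simp add: mul_linear mul_mul_self algebra_simps)

lemma right_alternative: "mul (mul y x) z + mul (mul y z) x = mul y (mul x z + mul z x)"
  using mul_self_mul[of y "x + z"]
  by (simp add: mul_linear mul_self_mul algebra_simps)

lemma mul_anticommute:
  "mul x y + mul y x = scale (tr x) y + scale (tr y) x - scale (B x y) unit"
  using mul_self[of "x + y"]
  by (simp add: mul_linear polar_linear N_add mul_self[of x] mul_self[of y] scale_left_distrib scale_right_distrib algebra_simps)

end

section \<open>Peirce decomposition and Zorn coordinates\<close>

text \<open>A hyperbolic pair \<open>e 0\<close>, \<open>f 0\<close> gives the element
  \<open>mul (e 0) (bar (f 0))\<close> of norm 0 and trace \<open>B (e 0) (f 0) = 1\<close>; by
  \<open>mul_self\<close> these two values make it idempotent.\<close>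

lemma (in split_octonion_algebra) ex_idempotent:
  obtains e where "N e = 0" "tr e = 1"
proof -
  obtain n e f where span: "span (e ` {..<n::nat} \<union> f ` {..<n}) = UNIV"
    and N_sum: "\<And>x y. N (\<Sum>i<n. scale (x i) (e i) + scale (y i) (f i)) = (\<Sum>i<n. x i * y i)"
    using hyperbolic unfolding hyperbolic_form_def by blast
  have "n \<noteq> 0"
  proof
    assume "n = 0"
    then have "(UNIV :: 'b set) = span {}" using span by simp
    then have "dim (UNIV :: 'b set) = 0"
      by (metis card.empty dim_span_eq_card_independent independent_empty)
    then show False using dim_8 by simp
  qed
  have N_sum': "N (scale x (e 0) + scale y (f 0)) = x * y" for x y
  proof -
    have "(\<Sum>i<n. scale (if i = 0 then x else 0) (e i) + scale (if i = 0 then y else 0) (f i))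
        = (\<Sum>i<n. if i = 0 then scale x (e 0) + scale y (f 0) else 0)"
      by (intro sum.cong) auto
    also have "\<dots> = scale x (e 0) + scale y (f 0)" using \<open>n \<noteq> 0\<close> by simp
    moreover have "(\<Sum>i<n. (if i = 0 then x else 0) * (if i = 0 then y else 0))
        = (\<Sum>i<n. if i = 0 then x * y else 0)"
      by (intro sum.cong) auto
    moreover have "\<dots> = x * y" using \<open>n \<noteq> 0\<close> by simp
    ultimately show ?thesis
      using N_sum[of "\<lambda>i. if i = 0 then x else 0" "\<lambda>i. if i = 0 then y else 0"] by simp
  qed
  have "N (e 0) = 0" "B (e 0) (f 0) = 1"
    using N_sum'[of 1 0] N_sum'[of 0 1] N_sum'[of 1 1] by (simp_all add: polar_def)
  then show ?thesis
    by (intro that[of "mul (e 0) (bar (f 0))"])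
      (simp_all add: multiplicative polar_mul_right bar_bar unit_left)
qed

locale octonion_algebra_idempotent = octonion_algebra scale mul unit N
  for scale :: "'k::field \<Rightarrow> 'c::ab_group_add \<Rightarrow> 'c" and mul unit N +
  fixes e :: 'c
  assumes N_e: "N e = 0" and tr_e: "B e unit = 1"
begin

section \<open>The complementary idempotent and the Peirce spaces\<close>

definition "e' = unit - e"

lemma e'_eq_bar: "e' = bar e" by (simp add: e'_def bar_def tr_e)

lemma N_e': "N e' = 0" by (simp add: e'_eq_bar N_bar N_e)

lemma tr_e': "tr e' = 1" by (simp add: e'_def polar_linear tr_e tr_unit)

lemma polar_e_e: "B e e = 0"
  using N_scale[of 2 e] scale_left_distrib[of 1 1 e] by (simp add: polar_def N_e)

lemma polar_e_e': "B e e' = 1"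
  by (simp add: e'_def polar_linear polar_e_e tr_e)

lemma polar_e'_e: "B e' e = 1"
  by (simp add: polar_commute[of e'] polar_e_e')

lemma polar_e'_e': "B e' e' = 0"
  using N_scale[of 2 e'] scale_left_distrib[of 1 1 e'] by (simp add: polar_def N_e')

lemma mul_e_e: "mul e e = e" by (simp add: mul_self N_e tr_e)

lemma mul_e'_e': "mul e' e' = e'" by (simp add: mul_self N_e' tr_e')

lemma mul_e_e': "mul e e' = 0" by (simp add: e'_def mul_linear mul_e_e)

lemma mul_e'_e: "mul e' e = 0" by (simp add: e'_def mul_linear mul_e_e)

text \<open>\<open>U\<close> and \<open>V\<close> are the Peirce spaces: the orthogonal complement
  of \<open>e\<close> and \<open>e'\<close>, split by the eigenvalues 1 and 0 of left multiplication
  by \<open>e\<close>. For vector matrices they are the two off-diagonal corners.\<close>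

definition "U = {x. tr x = 0 \<and> B x e = 0 \<and> mul e x = x}"
definition "V = {x. tr x = 0 \<and> B x e = 0 \<and> mul e x = 0}"

lemma UD:
  assumes "x \<in> U"
  shows "mul e x = x" "mul x e = 0" "mul e' x = 0" "mul x e' = x" "tr x = 0" "B x e = 0"
    "B x e' = 0" "N x = 0" "mul x x = 0" "B e x = 0" "B e' x = 0"
proof -
  show x: "mul e x = x" "tr x = 0" "B x e = 0" using assms by (auto simp: U_def)
  show "mul x e = 0" using mul_anticommute[of x e] by (simp add: x tr_e)
  then show "mul e' x = 0" "mul x e' = x" "B x e' = 0"
    by (simp_all add: e'_def mul_linear polar_linear x)
  then show "B e x = 0" "B e' x = 0" using x(3) by (simp_all add: polar_commute)
  show "N x = 0" using multiplicative[of e x] by (simp add: x N_e)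
  then show "mul x x = 0" by (simp add: mul_self x)
qed

lemma VD:
  assumes "x \<in> V"
  shows "mul e x = 0" "mul x e = x" "mul e' x = x" "mul x e' = 0" "tr x = 0" "B x e = 0"
    "B x e' = 0" "N x = 0" "mul x x = 0" "B e x = 0" "B e' x = 0"
proof -
  show x: "mul e x = 0" "tr x = 0" "B x e = 0" using assms by (auto simp: V_def)
  show "mul x e = x" using mul_anticommute[of x e] by (simp add: x tr_e)
  then show x': "mul e' x = x" "mul x e' = 0" "B x e' = 0"
    by (simp_all add: e'_def mul_linear polar_linear x)
  then show "B e x = 0" "B e' x = 0" using x(3) by (simp_all add: polar_commute)
  show "N x = 0" using multiplicative[of e' x] by (simp add: x' N_e')
  then show "mul x x = 0" by (simp add: mul_self x)
qed

lemma U_lin: "x \<in> U \<Longrightarrow> y \<in> U \<Longrightarrow> x + y \<in> U" "x \<in> U \<Longrightarrow> y \<in> U \<Longrightarrow> x - y \<in> U"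
    "x \<in> U \<Longrightarrow> scale a x \<in> U" "x \<in> U \<Longrightarrow> - x \<in> U" "0 \<in> U"
  by (auto simp: U_def mul_linear polar_linear)

lemma V_lin: "x \<in> V \<Longrightarrow> y \<in> V \<Longrightarrow> x + y \<in> V" "x \<in> V \<Longrightarrow> y \<in> V \<Longrightarrow> x - y \<in> V"
    "x \<in> V \<Longrightarrow> scale a x \<in> V" "x \<in> V \<Longrightarrow> - x \<in> V" "0 \<in> V"
  by (auto simp: V_def mul_linear polar_linear)

lemma polar_U_U: "x \<in> U \<Longrightarrow> y \<in> U \<Longrightarrow> B x y = 0"
  using UD(8) U_lin(1) by (simp add: polar_def)

lemma polar_V_V: "x \<in> V \<Longrightarrow> y \<in> V \<Longrightarrow> B x y = 0"
  using VD(8) V_lin(1) by (simp add: polar_def)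

text \<open>Once the components along the hyperbolic pair \<open>e\<close>, \<open>e'\<close> are
  removed, left multiplication by \<open>e\<close> is a projection by left alternativity; it splits
  the rest into parts in \<open>U\<close> and \<open>V\<close>.\<close>

lemma Peirce_decomposition:
  obtains u v where "u \<in> U" "v \<in> V" "z = scale (B z e') e + scale (B z e) e' + u + v"
proof -
  define z0 where "z0 = z - scale (B z e') e - scale (B z e) e'"
  have z0: "B z0 e = 0" "B z0 e' = 0"
    by (simp_all add: z0_def polar_linear polar_e_e polar_e_e' polar_e'_e polar_e'_e')
  then have "tr z0 = 0" by (simp add: e'_def polar_linear)
  note z0 = z0 this
  have "B (mul e z0) e = N e * B z0 unit"
    using polar_mul_left_same[of e z0 unit] by (simp add: unit_right)
  moreover have "tr (mul e z0) = B z0 (bar e)"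
    by (simp add: polar_mul_left unit_right)
  ultimately have ez0: "B (mul e z0) e = 0" "tr (mul e z0) = 0"
    by (simp_all add: N_e bar_def polar_linear z0)
  have "mul e (mul e z0) = mul e z0" by (simp add: mul_mul_self mul_e_e)
  then have "mul e z0 \<in> U" "z0 - mul e z0 \<in> V"
    by (auto simp: U_def V_def mul_linear polar_linear z0 ez0)
  then show ?thesis by (rule that) (simp add: z0_def)
qed

text \<open>\<open>U\<close> is orthogonal to \<open>e\<close>, \<open>e'\<close> and itself, so
  nondegeneracy of the norm becomes a pairing of \<open>U\<close> with \<open>V\<close>.\<close>

lemma polar_U_eq_0: "x = 0" if "x \<in> U" "\<And>v. v \<in> V \<Longrightarrow> B x v = 0"
proof (rule polar_eqI)
  fix z
  obtain u v where "u \<in> U" "v \<in> V" "z = scale (B z e') e + scale (B z e) e' + u + v"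
    by (rule Peirce_decomposition)
  then have "B x z = B x (scale (B z e') e + scale (B z e) e' + u + v)" by simp
  then show "B x z = B 0 z"
    using that \<open>u \<in> U\<close> \<open>v \<in> V\<close> by (simp add: polar_linear UD(6,7) polar_U_U)
qed

lemma polar_V_eq_0: "x = 0" if "x \<in> V" "\<And>u. u \<in> U \<Longrightarrow> B u x = 0"
proof (rule polar_eqI)
  fix z
  obtain u v where "u \<in> U" "v \<in> V" "z = scale (B z e') e + scale (B z e) e' + u + v"
    by (rule Peirce_decomposition)
  then have "B x z = B x (scale (B z e') e + scale (B z e) e' + u + v)" by simp
  then show "B x z = B 0 z"
    using that \<open>u \<in> U\<close> \<open>v \<in> V\<close>
    by (simp add: polar_linear VD(6,7) polar_V_V polar_commute[of x u])
qed

text \<open>By left alternativity, left multiplication by \<open>e\<close> fixes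
  \<open>mul x v\<close> and kills \<open>mul v x\<close>. Applied to the anticommutator, a multiple
  of \<open>unit\<close>, it separates the two products.\<close>

lemma mul_U_V:
  assumes "x \<in> U" "v \<in> V"
  shows "mul x v = - scale (B x v) e" "mul v x = - scale (B x v) e'"
proof -
  have *: "mul x v + mul v x = - scale (B x v) unit"
    using mul_anticommute[of x v] assms by (simp add: UD(5) VD(5))
  have "mul e (mul x v) = mul x v"
    using left_alternative[of e x v] assms by (simp add: UD VD mul_linear)
  moreover have "mul e (mul v x) = 0"
    using left_alternative[of e v x] assms by (simp add: UD VD mul_linear)
  ultimately show xv: "mul x v = - scale (B x v) e"
    using arg_cong[OF *, of "mul e"] by (simp add: mul_linear)
  show "mul v x = - scale (B x v) e'"
    using * by (simp add: xv e'_def algebra_simps)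
qed

section \<open>The product of two elements of \<open>U\<close>\<close>

lemma mul_U_U: "mul x y \<in> V" if "x \<in> U" "y \<in> U"
proof -
  have "tr (mul x y) = 0" "B (mul x y) e = 0"
    using that by (simp_all add: polar_mul_left mul_linear bar_def UD(2,5) polar_linear
        polar_U_U)
  moreover have "mul e (mul x y) = 0"
    using left_alternative[of e x y] that by (simp add: UD mul_linear)
  ultimately show ?thesis by (simp add: V_def)
qed

lemma mul_U_commute: "mul y x = - mul x y" if "x \<in> U" "y \<in> U"
proof -
  have "mul x y + mul y x = 0"
    using mul_anticommute[of x y] that by (simp add: UD(5) polar_U_U)
  then show ?thesis by (simp add: eq_neg_iff_add_eq_0 add.commute)
qed

lemma mul_V_commute: "mul y x = - mul x y" if "x \<in> V" "y \<in> V"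
proof -
  have "mul x y + mul y x = 0"
    using mul_anticommute[of x y] that by (simp add: VD(5) polar_V_V)
  then show ?thesis by (simp add: eq_neg_iff_add_eq_0 add.commute)
qed

lemma ex_dual_V:
  assumes "x \<in> U" "x \<noteq> 0"
  obtains v where "v \<in> V" "B x v = 1"
proof -
  obtain w where w: "w \<in> V" "B x w \<noteq> 0" using polar_U_eq_0 assms by blast
  then have "scale (inverse (B x w)) w \<in> V" "B x (scale (inverse (B x w)) w) = 1"
    by (simp_all add: V_lin polar_linear)
  then show ?thesis by (rule that)
qed

text \<open>Subtracting a multiple of \<open>x\<close> makes \<open>y\<close> orthogonal to
  \<open>w1\<close>. For \<open>w'\<close> in \<open>V\<close> orthogonal to \<open>x\<close>, right
  alternativity then turns \<open>mul x y' = 0\<close> into \<open>B y' w' = 0\<close>, so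
  \<open>y'\<close> pairs trivially with all of \<open>V\<close>.\<close>

lemma mul_U_U_eq_0:
  assumes x: "x \<in> U" "x \<noteq> 0" and y: "y \<in> U" and "mul x y = 0"
  shows "\<exists>c. y = scale c x"
proof -
  obtain w1 where w1: "w1 \<in> V" "B x w1 = 1" by (rule ex_dual_V[OF x])
  define y' where "y' = y - scale (B y w1) x"
  have y': "y' \<in> U" "mul x y' = 0" "B y' w1 = 0"
    using assms w1 by (simp_all add: y'_def U_lin mul_linear UD polar_linear)
  have "y' = 0"
  proof (rule polar_U_eq_0)
    fix w assume w: "w \<in> V"
    define w' where "w' = w - scale (B x w) w1"
    have w': "w' \<in> V" "B x w' = 0" "B y' w' = B y' w"
      using w w1 y' by (simp_all add: w'_def V_lin polar_linear)
    have "mul y' w' + mul w' y' = - scale (B y' w') unit"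
      using mul_anticommute[of y' w'] y' w' by (simp add: UD VD)
    then have "scale (B y' w') x = 0"
      using right_alternative[of x y' w'] x y' w' by (simp add: mul_U_V mul_linear)
    then show "B y' w = 0" using x w' by simp
  qed (rule y')
  then show ?thesis by (auto simp: y'_def)
qed

text \<open>If all products vanished, \<open>mul_U_U_eq_0\<close> would make \<open>U\<close>, and
  by duality \<open>V\<close>, at most one-dimensional, leaving total dimension at most 4.\<close>

lemma ex_mul_U_U_nonzero: "\<exists>x\<in>U. \<exists>y\<in>U. mul x y \<noteq> 0"
proof (rule ccontr)
  assume *: "\<not> ?thesis"
  obtain x where x: "x \<in> U" "\<And>y. y \<in> U \<Longrightarrow> \<exists>c. y = scale c x"
  proof (cases "\<exists>x\<in>U. x \<noteq> 0")
    case True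
    then show ?thesis using mul_U_U_eq_0 * that by metis
  next
    case False
    then have "y = scale 0 0" if "y \<in> U" for y using that by auto
    then show ?thesis using that U_lin(5) by blast
  qed
  obtain v where v: "\<And>w. w \<in> V \<Longrightarrow> \<exists>c. w = scale c v"
  proof (cases "x = 0")
    case True
    have "w = scale 0 0" if "w \<in> V" for w
      using polar_V_eq_0[OF that] x(2) True by (force simp: polar_linear)
    then show ?thesis using that by blast
  next
    case False
    then obtain v where v: "v \<in> V" "B x v = 1" using ex_dual_V[OF x(1)] by metis
    have "w = scale (B x w) v" if w: "w \<in> V" for w
    proof -
      have "w - scale (B x w) v = 0"
      proof (rule polar_V_eq_0)
        fix u assume "u \<in> U"
        then obtain c where "u = scale c x" using x(2) by blast
        then show "B u (w - scale (B x w) v) = 0" by (simp add: polar_linear v)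
      qed (simp add: v w V_lin)
      then show ?thesis by simp
    qed
    then show ?thesis using that by blast
  qed
  have "z \<in> span {e, e', x, v}" for z
  proof -
    obtain u w where "u \<in> U" "w \<in> V" "z = scale (B z e') e + scale (B z e) e' + u + w"
      by (rule Peirce_decomposition)
    moreover obtain c d where "u = scale c x" "w = scale d v" using x v calculation by metis
    ultimately have "z = scale (B z e') e + scale (B z e) e' + scale c x + scale d v" by simp
    also have "\<dots> \<in> span {e, e', x, v}" by (intro span_add span_scale span_base) auto
    finally show ?thesis .
  qed
  then have "dim (UNIV :: 'c set) \<le> card {e, e', x, v}" by (intro dim_le_card) auto
  also have "\<dots> \<le> 4" using card_length[of "[e, e', x, v]"] by simp
  finally show False using dim_8 by simp
qed

text \<open>
  \<open>B (mul x y) z\<close> is an alternating trilinear form on \<open>U\<close>; \<open>U\<close> is three-dimensional, and the triples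
  satisfying the following condition are the bases of volume one with respect to this form.
\<close>

definition "unimodular x y z \<longleftrightarrow> x \<in> U \<and> y \<in> U \<and> z \<in> U \<and> B (mul x y) z = - 1"

lemma ex_unimodular: obtains x y z where "unimodular x y z"
proof -
  obtain x y where xy: "x \<in> U" "y \<in> U" "mul x y \<noteq> 0" using ex_mul_U_U_nonzero by blast
  then have V: "mul x y \<in> V" by (simp add: mul_U_U)
  then obtain z where z: "z \<in> U" "B z (mul x y) \<noteq> 0" using polar_V_eq_0 xy by blast
  have "unimodular x y (scale (- inverse (B z (mul x y))) z)"
    using xy z by (simp add: unimodular_def U_lin polar_linear polar_commute[of "mul x y"])
  then show ?thesis by (rule that)
qed

text \<open>Adjointness with \<open>bar y = - y\<close> and anticommutativity on \<open>U\<close>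
  make the trilinear form cyclically invariant; facts about one position of the triple thus transfer
  to the other two.\<close>

lemma unimodular_rotate: "unimodular y z x" if "unimodular x y z"
proof -
  have xyz: "x \<in> U" "y \<in> U" "z \<in> U" "B (mul x y) z = - 1"
    using that by (auto simp: unimodular_def)
  have "B (mul y z) x = B z (mul (- y) x)"
    using xyz by (simp add: polar_mul_left bar_def UD)
  also have "\<dots> = B (mul x y) z"
    using mul_U_commute[OF xyz(2,1)] by (simp add: mul_linear polar_commute)
  finally show ?thesis using xyz by (simp add: unimodular_def)
qed

text \<open>Up to sign, \<open>mul y z\<close>, \<open>mul z x\<close>, \<open>mul x y\<close> are
  dual to \<open>x\<close>, \<open>y\<close>, \<open>z\<close>; rotating the triple supplies the
  remaining pairings.\<close>

lemma unimodular_polar: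
  assumes "unimodular x y z"
  shows "B x (mul y z) = - 1" "B (mul y z) x = - 1" "B y (mul y z) = 0" "B (mul y z) y = 0"
    "B z (mul y z) = 0" "B (mul y z) z = 0"
proof -
  have xyz: "x \<in> U" "y \<in> U" "z \<in> U" using assms by (auto simp: unimodular_def)
  show 1: "B (mul y z) x = - 1" using unimodular_rotate[OF assms] by (auto simp: unimodular_def)
  have 2: "B (mul y z) y = B z (mul (- y) y)"
    using xyz by (simp add: polar_mul_left bar_def UD)
  show 3: "B (mul y z) y = 0" using xyz unfolding 2 by (simp add: mul_linear UD polar_linear)
  have 4: "B (mul y z) z = B y (mul z (- z))"
    using xyz by (simp add: polar_mul_right bar_def UD)
  show 5: "B (mul y z) z = 0" using xyz unfolding 4 by (simp add: mul_linear UD polar_linear)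
  show "B x (mul y z) = - 1" "B y (mul y z) = 0" "B z (mul y z) = 0"
    using 1 3 5 by (simp_all add: polar_commute)
qed

text \<open>\<open>mul y z\<close> and \<open>z\<close> multiply to zero in both orders, so left
  alternativity reduces the product to \<open>- mul z (mul (mul y z) x)\<close>, where
  \<open>mul (mul y z) x = e'\<close>.\<close>

lemma unimodular_mul_V:
  assumes "unimodular x y z"
  shows "mul (mul y z) (mul z x) = - z" "mul (mul z x) (mul y z) = z"
proof -
  have xyz: "x \<in> U" "y \<in> U" "z \<in> U" using assms by (auto simp: unimodular_def)
  show 1: "mul (mul y z) (mul z x) = - z"
    using left_alternative[of "mul y z" z x] xyz unimodular_polar[OF assms]
    by (simp add: mul_U_V mul_U_U mul_linear UD eq_neg_iff_add_eq_0)
  then show "mul (mul z x) (mul y z) = z"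
    using mul_V_commute[of "mul y z" "mul z x"] xyz by (simp add: mul_U_U)
qed

text \<open>Subtracting the expected combination leaves \<open>u'\<close> orthogonal to the dual
  vectors. Left alternativity gives \<open>mul u' z = 0\<close>, so \<open>u'\<close> is a multiple
  of \<open>z\<close>, and pairing with \<open>mul x y\<close> shows that it vanishes.\<close>

lemma unimodular_U_eq:
  assumes xyz: "unimodular x y z" and u: "u \<in> U"
  shows "u = - (scale (B u (mul y z)) x + scale (B u (mul z x)) y + scale (B u (mul x y)) z)"
proof -
  note yzx = unimodular_rotate[OF xyz]
  note zxy = unimodular_rotate[OF yzx]
  have U: "x \<in> U" "y \<in> U" "z \<in> U" using xyz by (auto simp: unimodular_def)
  define u' where
    "u' = u + (scale (B u (mul y z)) x + scale (B u (mul z x)) y + scale (B u (mul x y)) z)"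
  have u': "u' \<in> U" "B u' (mul y z) = 0" "B u' (mul z x) = 0" "B u' (mul x y) = 0"
    using u U unimodular_polar[OF xyz] unimodular_polar[OF yzx] unimodular_polar[OF zxy]
    by (simp_all add: u'_def U_lin polar_linear)
  have "mul u' z = 0"
    using left_alternative[of "mul y z" u' "mul z x"] u' U unimodular_mul_V[OF xyz]
    by (simp add: mul_U_V mul_U_U mul_linear)
  then have "mul z u' = 0" using mul_U_commute[of u' z] u' U by simp
  moreover have "z \<noteq> 0" using xyz by (auto simp: unimodular_def polar_linear)
  ultimately obtain c where c: "u' = scale c z" using mul_U_U_eq_0 U u' by metis
  then have "c = 0" using u'(4) unimodular_polar[OF zxy] by (simp add: polar_linear)
  then show ?thesis unfolding eq_neg_iff_add_eq_0 using c by (simp add: u'_def)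
qed

lemma unimodular_V_eq:
  assumes xyz: "unimodular x y z" and v: "v \<in> V"
  shows "v = - (scale (B x v) (mul y z) + scale (B y v) (mul z x) + scale (B z v) (mul x y))"
proof -
  note yzx = unimodular_rotate[OF xyz]
  note zxy = unimodular_rotate[OF yzx]
  have U: "x \<in> U" "y \<in> U" "z \<in> U" using xyz by (auto simp: unimodular_def)
  define v' where
    "v' = v + (scale (B x v) (mul y z) + scale (B y v) (mul z x) + scale (B z v) (mul x y))"
  have orth: "B x v' = 0" "B y v' = 0" "B z v' = 0"
    using unimodular_polar[OF xyz] unimodular_polar[OF yzx] unimodular_polar[OF zxy]
    by (simp_all add: v'_def polar_linear)
  have "v' = 0"
  proof (rule polar_V_eq_0)
    show "v' \<in> V" using v U by (simp add: v'_def V_lin mul_U_U)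
    fix u assume "u \<in> U"
    from unimodular_U_eq[OF xyz this] orth show "B u v' = 0"
      by (metis (no_types, lifting) polar_add_left polar_minus_left polar_scale_left
          add.right_neutral minus_zero mult_zero_right)
  qed
  then show ?thesis unfolding eq_neg_iff_add_eq_0 by (simp add: v'_def)
qed

end

section \<open>Identification with Zorn's vector matrices\<close>

lemma (in split_octonion_algebra) zorn_isomorphism:
  obtains \<phi> :: "'a zorn \<Rightarrow> 'b"
  where "bij \<phi>" "\<And>x y. \<phi> (x + y) = \<phi> x + \<phi> y" "\<And>a x. \<phi> (zorn_scale a x) = scale a (\<phi> x)"
    "\<And>x y. \<phi> (zorn_mul x y) = mul (\<phi> x) (\<phi> y)" "\<phi> (1,1,0,0,0,0,0,0) = unit"
proof -
  obtain e where "N e = 0" "tr e = 1" by (rule ex_idempotent)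
  then interpret octonion_algebra_idempotent scale mul unit N e by unfold_locales
  obtain x y z where xyz: "unimodular x y z" by (rule ex_unimodular)
  note yzx = unimodular_rotate[OF xyz]
  note zxy = unimodular_rotate[OF yzx]
  have U: "x \<in> U" "y \<in> U" "z \<in> U" using xyz by (auto simp: unimodular_def)
  have V: "mul y z \<in> V" "mul z x \<in> V" "mul x y \<in> V" using U by (simp_all add: mul_U_U)
  define x' y' z' where "x' = mul y z" and "y' = mul z x" and "z' = mul x y"
  note defs = x'_def[symmetric] y'_def[symmetric] z'_def[symmetric]
  define \<phi> :: "'a zorn \<Rightarrow> 'b" where "\<phi> = (\<lambda>(a, b, v1, v2, v3, w1, w2, w3).
    scale a e + scale b e' + scale v1 x + scale v2 y + scale v3 z
      + scale w1 x' + scale w2 y' + scale w3 z')"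
  note polars = unimodular_polar[OF xyz] unimodular_polar[OF yzx] unimodular_polar[OF zxy]
  note muls = mul_e_e mul_e'_e' mul_e_e' mul_e'_e
    UD(1-4,9)[OF U(1)] UD(1-4,9)[OF U(2)] UD(1-4,9)[OF U(3)]
    VD(1-4,9)[OF V(1)] VD(1-4,9)[OF V(2)] VD(1-4,9)[OF V(3)]
    mul_U_V[OF U(1) V(1)] mul_U_V[OF U(1) V(2)] mul_U_V[OF U(1) V(3)]
    mul_U_V[OF U(2) V(1)] mul_U_V[OF U(2) V(2)] mul_U_V[OF U(2) V(3)]
    mul_U_V[OF U(3) V(1)] mul_U_V[OF U(3) V(2)] mul_U_V[OF U(3) V(3)]
    unimodular_mul_V[OF xyz] unimodular_mul_V[OF yzx] unimodular_mul_V[OF zxy]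
    mul_U_commute[OF U(1,2)] mul_U_commute[OF U(2,3)] mul_U_commute[OF U(3,1)]
  \<comment> \<open>The pairings become the constants 0 and - 1 and the three products become atoms,
    so that multiplicativity of \<open>\<phi>\<close> is a computation in a multiplication
    table.\<close>
  note table = muls[unfolded polars, unfolded defs]
  have add: "\<phi> (s + t) = \<phi> s + \<phi> t" for s t
    by (cases s rule: zorn_cases; cases t rule: zorn_cases)
      (simp add: \<phi>_def scale_left_distrib algebra_simps)
  have scale: "\<phi> (zorn_scale a s) = scale a (\<phi> s)" for a s
    by (cases s rule: zorn_cases) (simp add: \<phi>_def scale_right_distrib)
  have mul: "\<phi> (zorn_mul s t) = mul (\<phi> s) (\<phi> t)" for s t
    by (cases s rule: zorn_cases; cases t rule: zorn_cases)
      (simp add: \<phi>_def mul_linear table defs scale_left_distrib scale_right_distrib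
        scale_left_diff_distrib scale_right_diff_distrib algebra_simps)
  have unit: "\<phi> (1,1,0,0,0,0,0,0) = unit" by (simp add: \<phi>_def e'_def)
  have "inj \<phi>"
  proof (rule inj_on_inverseI)
    fix s
    \<comment> \<open>Pairing with the dual vectors recovers each coordinate.\<close>
    show "(B (\<phi> s) e', B (\<phi> s) e, - B (\<phi> s) x', - B (\<phi> s) y', - B (\<phi> s) z',
        - B (\<phi> s) x, - B (\<phi> s) y, - B (\<phi> s) z) = s"
      by (cases s rule: zorn_cases) (simp add: \<phi>_def polar_linear polar_e_e polar_e_e' polar_e'_e polar_e'_e'
          U[THEN UD(6)] U[THEN UD(7)] U[THEN UD(10)] U[THEN UD(11)]
          V[THEN VD(6), unfolded defs] V[THEN VD(7), unfolded defs]
          V[THEN VD(10), unfolded defs] V[THEN VD(11), unfolded defs]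
          polars[unfolded defs] polar_U_U U polar_V_V V[unfolded defs])
  qed
  moreover have "surj \<phi>"
  proof (unfold surj_def, rule allI)
    fix t
    obtain u v where uv: "u \<in> U" "v \<in> V" "t = scale (B t e') e + scale (B t e) e' + u + v"
      by (rule Peirce_decomposition)
    have "t = \<phi> (B t e', B t e, - B u x', - B u y', - B u z', - B x v, - B y v, - B z v)"
      (is "t = ?r")
    proof -
      note u = unimodular_U_eq[OF xyz uv(1), unfolded defs]
      note v = unimodular_V_eq[OF xyz uv(2), unfolded defs]
      have "?r = scale (B t e') e + scale (B t e) e'
          + - (scale (B u x') x + scale (B u y') y + scale (B u z') z)
          + - (scale (B x v) x' + scale (B y v) y' + scale (B z v) z')"
        by (simp add: \<phi>_def algebra_simps)
      also have "\<dots> = t" by (simp only: u[symmetric] v[symmetric] uv(3)[symmetric])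
      finally show ?thesis by simp
    qed
    then show "\<exists>s. t = \<phi> s" ..
  qed
  ultimately have "bij \<phi>" by (simp add: bij_def)
  from that[OF this add scale mul unit] show ?thesis .
qed

section \<open>A cubic torus element\<close>

text \<open>
  With \<open>A\<close> the companion matrix of \<open>X\<^sup>3 + a X\<^sup>2 + b X - 1\<close> with respect to the basis
  \<open>(q, 0, 0), (0, 1, 0), (0, 0, 1)\<close>, this is \<open>(x, y, v, w) \<mapsto> (x, y, A v, A\<^sup>-\<^sup>T w)\<close>.
\<close>

fun zorn_cubic :: "'k::field \<Rightarrow> 'k \<Rightarrow> 'k \<Rightarrow> 'k zorn \<Rightarrow> 'k zorn" where
  "zorn_cubic a b q (x, y, v1, v2, v3, w1, w2, w3) =
    (x, y, q * v3, v1 / q - b * v3, v2 - a * v3, b * w1 + a / q * w2 + w3 / q, q * w1, w2)"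

fun zorn_cubic_inv :: "'k::field \<Rightarrow> 'k \<Rightarrow> 'k \<Rightarrow> 'k zorn \<Rightarrow> 'k zorn" where
  "zorn_cubic_inv a b q (x, y, v1, v2, v3, w1, w2, w3) =
    (x, y, b * v1 + q * v2, a / q * v1 + v3, v1 / q, w2 / q, w3, q * w1 - b * w2 - a * w3)"

lemma zorn_cubic_inverses:
  assumes "q \<noteq> 0"
  shows "zorn_cubic a b q (zorn_cubic_inv a b q s) = s" "zorn_cubic_inv a b q (zorn_cubic a b q s) = s"
  using assms by (cases s rule: zorn_cases; simp add: field_simps)+

lemma zorn_cubic_add: "zorn_cubic a b q (s + t) = zorn_cubic a b q s + zorn_cubic a b q t"
  by (cases s rule: zorn_cases; cases t rule: zorn_cases) (simp add: algebra_simps add_divide_distrib)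

lemma zorn_cubic_scale: "zorn_cubic a b q (zorn_scale c s) = zorn_scale c (zorn_cubic a b q s)"
  by (cases s rule: zorn_cases) (simp add: algebra_simps add_divide_distrib)

text \<open>\<open>A\<close> has determinant 1, so \<open>A\<close> and its inverse transpose are
  compatible with cross products and preserve the dot product of \<open>v\<close> and
  \<open>w\<close>.\<close>

lemma zorn_cubic_mul:
  assumes "q \<noteq> 0"
  shows "zorn_cubic a b q (zorn_mul s t) = zorn_mul (zorn_cubic a b q s) (zorn_cubic a b q t)"
  using assms by (cases s rule: zorn_cases; cases t rule: zorn_cases) (simp add: field_simps)

text \<open>
  The Hankel determinant with entries \<open>s\<^sub>i\<^sub>+\<^sub>j\<close>, where \<open>s\<^sub>n\<^sub>+\<^sub>3 = s\<^sub>n - b s\<^sub>n\<^sub>+\<^sub>1 - a s\<^sub>n\<^sub>+\<^sub>2\<close>. For a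
  root \<open>\<alpha>\<close> of \<open>X\<^sup>3 + a X\<^sup>2 + b X - 1\<close> it is the determinant of the bilinear form
  \<open>(x, y) \<mapsto> \<lambda> (x y)\<close> on \<open>k[\<alpha>]\<close>, \<open>\<lambda>\<close> being the linear functional with \<open>\<lambda> (\<alpha>\<^sup>n) = s\<^sub>n\<close>.
\<close>

definition hankel :: "'k::comm_ring_1 \<Rightarrow> 'k \<Rightarrow> 'k \<Rightarrow> 'k \<Rightarrow> 'k \<Rightarrow> 'k" where
  "hankel a b s0 s1 s2 =
    (let s3 = s0 - b * s1 - a * s2; s4 = s1 - b * s2 - a * s3
     in s0 * (s2 * s4 - s3 * s3) - s1 * (s1 * s4 - s2 * s3) + s2 * (s1 * s3 - s2 * s2))"

text \<open>The cubic has the value \<open>a + b\<close> at 1. If this is nonzero, 1 is an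
  eigenvalue neither of \<open>A\<close> nor of its inverse transpose, so only the diagonal is
  fixed.\<close>

lemma zorn_cubic_fixed:
  assumes "q \<noteq> 0" "a + b \<noteq> 0" "zorn_cubic a b q s = s"
  obtains x y where "s = (x, y, 0, 0, 0, 0, 0, 0)"
proof (cases s rule: zorn_cases)
  case (fields x y v1 v2 v3 w1 w2 w3)
  have v: "q * v3 = v1" "v1 / q - b * v3 = v2" "v2 - a * v3 = v3"
    and w: "b * w1 + a / q * w2 + w3 / q = w1" "q * w1 = w2" "w2 = w3"
    using assms(3) unfolding fields by (auto simp only: zorn_cubic.simps prod.inject)
  have "v2 = v3 - b * v3" unfolding v(2)[symmetric] v(1)[symmetric] using assms(1) by simp
  with v(3) have "(a + b) * v3 = 0" by (simp add: algebra_simps)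
  then have "v3 = 0" using assms(2) by simp
  have "q * (b * w1 + a / q * w2 + w3 / q) = b * (q * w1) + a * w2 + w3"
    using assms(1) by (simp add: distrib_left)
  then have "b * (q * w1) + a * w2 + w3 = q * w1" by (simp only: w(1))
  with w(2,3) have "(a + b) * w2 = 0" by (simp add: algebra_simps)
  then have "w2 = 0" using assms(2) by simp
  then show ?thesis using that v w \<open>v3 = 0\<close> assms(1) by (simp add: fields)
qed

section \<open>Automorphisms inverting the cubic element\<close>

lemma zorn_eigenspaces:
  "zorn_mul (1,0,0,0,0,0,0,0) s = s \<Longrightarrow> zorn_mul s (1,0,0,0,0,0,0,0) = 0 \<Longrightarrow>
    \<exists>v1 v2 v3. s = (0, 0, v1, v2, v3, 0, 0, 0)"
  "zorn_mul (0,1,0,0,0,0,0,0) s = s \<Longrightarrow> zorn_mul s (0,1,0,0,0,0,0,0) = 0 \<Longrightarrow>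
    \<exists>w1 w2 w3. s = (0, 0, 0, 0, 0, w1, w2, w3)"
  by (cases s rule: zorn_cases; force simp: zero_prod_def)+

text \<open>The conditions \<open>ab\<close> say that the cubic does not vanish at 1 and at -
  1.\<close>

locale zorn_cubic_inverting =
  fixes a b q :: "'k::field" and h :: "'k zorn \<Rightarrow> 'k zorn"
  assumes q: "q \<noteq> 0" and ab: "a + b \<noteq> 0" "a - b \<noteq> 2"
    and add: "h (s + t) = h s + h t" and scale: "h (zorn_scale c s) = zorn_scale c (h s)"
    and mul: "h (zorn_mul s t) = zorn_mul (h s) (h t)"
    and unit: "h (1,1,0,0,0,0,0,0) = (1,1,0,0,0,0,0,0)"
    and inj: "inj h"
    and inverting: "h (zorn_cubic a b q s) = zorn_cubic_inv a b q (h s)"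
begin

lemma zero: "h 0 = 0"
  using add[of 0 0] by simp

abbreviation "e \<equiv> (1,0,0,0,0,0,0,0) :: 'k zorn"
abbreviation "e' \<equiv> (0,1,0,0,0,0,0,0) :: 'k zorn"
abbreviation "u1 \<equiv> (0,0,1,0,0,0,0,0) :: 'k zorn"
abbreviation "u2 \<equiv> (0,0,0,1,0,0,0,0) :: 'k zorn"
abbreviation "u3 \<equiv> (0,0,0,0,1,0,0,0) :: 'k zorn"

text \<open>\<open>u1\<close> is a cyclic vector for \<open>A\<close>: \<open>h u1\<close>
  determines \<open>h u2\<close> and \<open>h u3\<close>, and the third identity is the relation
  that the cubic imposes on \<open>h u1\<close>.\<close>

lemma images:
  "h u2 = zorn_scale q (zorn_cubic_inv a b q (h u1))"
  "h u3 = zorn_cubic_inv a b q (h u2)"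
  "zorn_cubic_inv a b q (h u3)
    = zorn_scale q (h u1) + zorn_scale (- b) (h u2) + zorn_scale (- a) (h u3)"
proof -
  have "zorn_scale q (zorn_cubic a b q u1) = u2" using q by simp
  then show "h u2 = zorn_scale q (zorn_cubic_inv a b q (h u1))" by (metis inverting scale)
  have "zorn_cubic a b q u2 = u3" by simp
  then show "h u3 = zorn_cubic_inv a b q (h u2)" by (metis inverting)
  have "zorn_cubic a b q u3 = zorn_scale q u1 + zorn_scale (- b) u2 + zorn_scale (- a) u3"
    by simp
  then show "zorn_cubic_inv a b q (h u3)
      = zorn_scale q (h u1) + zorn_scale (- b) (h u2) + zorn_scale (- a) (h u3)"
    by (metis inverting scale add)
qed

lemma zorn_e_u1: "zorn_mul e u1 = u1" "zorn_mul u1 e = 0"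
  by (simp_all add: zero_prod_def)

text \<open>\<open>h e\<close> is fixed by the cubic element, hence diagonal, and as an idempotent
  it has entries 0 or 1; injectivity excludes 0 and the unit.\<close>

lemma image_e: "h e = e \<and> h e' = e' \<or> h e = e' \<and> h e' = e"
proof -
  have "zorn_cubic_inv a b q (h e) = h e" using inverting[of e] by simp
  then have "zorn_cubic a b q (h e) = h e" by (metis zorn_cubic_inverses(1)[OF q])
  then obtain x y where he: "h e = (x, y, 0, 0, 0, 0, 0, 0)"
    by (rule zorn_cubic_fixed[OF q ab(1)])
  have "zorn_mul (h e) (h e) = h e" using mul[of e e] by simp
  then have "x * x = x" "y * y = y" by (simp_all add: he)
  then have xy: "x = 0 \<or> x = 1" "y = 0 \<or> y = 1" by auto
  have sum: "h e + h e' = (1,1,0,0,0,0,0,0)" using add[of e e'] unit by simp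
  have "h e \<noteq> 0" "h e' \<noteq> 0"
    using injD[OF inj, of e 0] injD[OF inj, of e' 0] unfolding zero by (auto simp: zero_prod_def)
  have he': "h e' = (1,1,0,0,0,0,0,0) - h e" using sum by (simp add: algebra_simps)
  show ?thesis using xy \<open>h e \<noteq> 0\<close> \<open>h e' \<noteq> 0\<close> by (auto simp: he he' zero_prod_def)
qed

text \<open>Let \<open>T\<close> be the inverse of \<open>A\<close> and \<open>w = h u1\<close>.
  Then \<open>T^3 w = w - b T w - a T^2 w\<close> by \<open>images\<close>, whereas
  \<open>T^3 = b T^2 + a T + 1\<close>. Comparison gives \<open>T w = - w\<close>, which would make
  - 1 a root of the cubic.\<close>

lemma not_fixing: "h e \<noteq> e"
proof
  assume he: "h e = e"
  have "zorn_mul e (h u1) = h u1" "zorn_mul (h u1) e = 0"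
    using mul[of e u1] mul[of u1 e] zorn_e_u1 by (simp_all only: he zero)
  then obtain v1 y z where hv1: "h u1 = (0, 0, v1, y, z, 0, 0, 0)"
    using zorn_eigenspaces(1) by blast
  define x where "x = v1 / q"
  have hu1: "h u1 = (0, 0, q * x, y, z, 0, 0, 0)" using hv1 q by (simp add: x_def)
  \<comment> \<open>The triple \<open>(x, y, z)\<close> stands for the vector
    \<open>(q x, y, z)\<close>; the primed and doubly primed triples are its images under the
    inverse of \<open>A\<close> and its square.\<close>
  define x' y' z' where "x' = b * x + y" and "y' = a * x + z" and "z' = x"
  define x'' y'' z'' where "x'' = b * x' + y'" and "y'' = a * x' + z'" and "z'' = x'"
  have hu2: "h u2 = (0, 0, q * q * x', q * y', q * z', 0, 0, 0)"
    using images(1) q by (simp add: hu1 x'_def y'_def z'_def algebra_simps)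
  have hu3: "h u3 = (0, 0, q * q * x'', q * y'', q * z'', 0, 0, 0)"
    using images(2) q by (simp add: hu2 x''_def y''_def z''_def algebra_simps)
  have 1: "q * q * (b * x'' + y'') = q * q * (x - b * x' - a * x'')"
    and 2: "q * (a * x'' + z'') = q * (y - b * y' - a * y'')"
    and 3: "q * x'' = q * (z - b * z' - a * z'')"
    using images(3) q unfolding hu1 hu2 hu3 by (simp_all add: algebra_simps)
  have eqs: "b * x'' + y'' = x - b * x' - a * x''" "a * x'' + z'' = y - b * y' - a * y''"
    "x'' = z - b * z' - a * z''"
    using 1 2 3 q by simp_all
  \<comment> \<open>Cayley-Hamilton for the inverse of \<open>A\<close>, in coordinates.\<close>
  have "b * x'' + a * x' + x = b * x'' + y''" "b * y'' + a * y' + y = a * x'' + z''"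
    "b * z'' + a * z' + z = x''"
    by (simp_all add: x'_def y'_def z'_def x''_def y''_def z''_def algebra_simps)
  from this(1)[THEN trans, OF eqs(1)] this(2)[THEN trans, OF eqs(2)] this(3)[THEN trans, OF eqs(3)]
  have "(a + b) * (x' + x'') = 0" "(a + b) * (y' + y'') = 0" "(a + b) * (z' + z'') = 0"
    by (simp_all add: algebra_simps)
  then have "x' + x'' = 0" "y' + y'' = 0" "z' + z'' = 0" using ab by simp_all
  then have *: "x' = - x" "(1 + b) * x' + y' = 0" "a * x' + y' + z' = 0"
    by (simp_all add: x''_def y''_def z''_def z'_def eq_neg_iff_add_eq_0 algebra_simps)
  have "y' = - ((1 + b) * x')" using *(2) by (simp only: add_eq_0_iff)
  then have "y' = (1 + b) * x" using *(1) by simp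
  with *(1,3) have "(a - b - 2) * x = 0" by (simp add: z'_def algebra_simps)
  then have "x = 0" using ab by simp
  then have "x' = 0" "y' = 0" using * by simp_all
  then have "h u1 = 0" using \<open>x = 0\<close> by (simp add: hu1 x'_def y'_def zero_prod_def)
  then show False using injD[OF inj, of u1 0] unfolding zero by (simp add: zero_prod_def)
qed

text \<open>\<open>h\<close> swaps the idempotents and moves \<open>u1\<close>, \<open>u2\<close>,
  \<open>u3\<close> into the \<open>w\<close> corner. By \<open>images\<close> their coordinates
  form a Hankel matrix up to factors \<open>q\<close>; the triple product \<open>e'\<close> of the
  three vectors goes to \<open>e\<close>, which fixes the determinant.\<close>

lemma ex_hankel: "\<exists>s0 s1 s2. q * hankel a b s0 s1 s2 = - 1"
proof -
  have he: "h e = e'" "h e' = e" using image_e not_fixing by auto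
  have "zorn_mul e' (h u1) = h u1" "zorn_mul (h u1) e' = 0"
    using mul[of e u1] mul[of u1 e] zorn_e_u1 by (simp_all only: he zero)
  then obtain w1 s1 s2 where hw1: "h u1 = (0, 0, 0, 0, 0, w1, s1, s2)"
    using zorn_eigenspaces(2) by blast
  define s0 where "s0 = q * w1"
  have hu1: "h u1 = (0, 0, 0, 0, 0, s0 / q, s1, s2)" using hw1 q by (simp add: s0_def)
  define s3 where "s3 = s0 - b * s1 - a * s2"
  define s4 where "s4 = s1 - b * s2 - a * s3"
  have hu2: "h u2 = (0, 0, 0, 0, 0, s1, q * s2, q * s3)"
    using images(1) q by (simp add: hu1 s3_def algebra_simps)
  have hu3: "h u3 = (0, 0, 0, 0, 0, s2, q * s3, q * s4)"
    using images(2) q by (simp add: hu2 s4_def algebra_simps)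
  have "zorn_mul (zorn_mul (h u1) (h u2)) (h u3) = h (zorn_mul (zorn_mul u1 u2) u3)"
    by (simp only: mul)
  also have "zorn_mul (zorn_mul u1 u2) u3 = e'" by simp
  finally have "q * hankel a b s0 s1 s2 = - 1"
    using q by (simp add: hu1 hu2 hu3 he hankel_def Let_def flip: s3_def s4_def) (simp add: field_simps)
  then show ?thesis by blast
qed

end

section \<open>Anisotropy of the Hankel determinant\<close>

text \<open>
  A vanishing Hankel determinant gives a linear recurrence of length two for the sequence
  \<open>s\<^sub>n\<close>; Euclidean division then yields a recurrence of length one, \<open>s\<^sub>n = s\<^sub>0 r\<^sup>n\<close>, unless the cubic is
  divisible by the characteristic polynomial of the recurrence.
\<close>

lemma hankel_anisotropic:
  fixes a b :: "'k::field"
  assumes root: "\<And>r. r ^ 3 + a * r\<^sup>2 + b * r - 1 \<noteq> 0"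
    and hankel: "hankel a b s0 s1 s2 = 0"
  shows "s0 = 0 \<and> s1 = 0 \<and> s2 = 0"
proof -
  define s3 where "s3 = s0 - b * s1 - a * s2"
  define s4 where "s4 = s1 - b * s2 - a * s3"
  \<comment> \<open>Such a recurrence makes a nonzero sequence geometric, and its ratio would be a
    root of the cubic.\<close>
  have geometric: "s0 = 0 \<and> s1 = 0 \<and> s2 = 0"
    if "c0 * s0 + c1 * s1 = 0" "c0 * s1 + c1 * s2 = 0" "c0 * s2 + c1 * s3 = 0" "c0 \<noteq> 0 \<or> c1 \<noteq> 0"
    for c0 c1
  proof (cases "c1 = 0")
    case True
    then show ?thesis using that by simp
  next
    case False
    define r where "r = - c0 / c1"
    have step: "y = r * x" if "c0 * x + c1 * y = 0" for x y
      using that False by (simp add: r_def field_simps add_eq_0_iff)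
    have s: "s1 = r * s0" "s2 = r * (r * s0)" "s3 = r * (r * (r * s0))"
      using step that by metis+
    then have "(r ^ 3 + a * r\<^sup>2 + b * r - 1) * s0 = 0"
      using s3_def by (simp add: algebra_simps power2_eq_square power3_eq_cube)
    then show ?thesis using root s by simp
  qed
  \<comment> \<open>The cofactors along the last row: they form a kernel vector of the singular
    Hankel matrix.\<close>
  define v0 v1 v2 where "v0 = s1 * s3 - s2 * s2" and "v1 = s1 * s2 - s0 * s3"
    and "v2 = s0 * s2 - s1 * s1"
  have "v0 * s0 + v1 * s1 + v2 * s2 = 0" "v0 * s1 + v1 * s2 + v2 * s3 = 0"
    by (simp_all add: v0_def v1_def v2_def algebra_simps)
  moreover have "v0 * s2 + v1 * s3 + v2 * s4 = 0"
    using hankel unfolding hankel_def Let_def s3_def[symmetric] s4_def[symmetric]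
    by (simp add: v0_def v1_def v2_def algebra_simps)
  ultimately have v: "v0 * s0 + v1 * s1 + v2 * s2 = 0" "v0 * s1 + v1 * s2 + v2 * s3 = 0"
    "v0 * s2 + v1 * s3 + v2 * s4 = 0" by auto
  show ?thesis
  proof (cases "v2 = 0")
    case True
    show ?thesis
    proof (cases "v0 = 0 \<and> v1 = 0")
      case True
      show ?thesis
      \<comment> \<open>With all three cofactors zero, \<open>- s1\<close> and \<open>s0\<close> are
        the coefficients of a recurrence of length one, nontrivial unless
        \<open>s0 = 0\<close>.\<close>
      proof (cases "s0 = 0")
        case True
        then show ?thesis using \<open>v2 = 0\<close> \<open>v0 = 0 \<and> v1 = 0\<close> by (simp add: v0_def v2_def)
      next
        case False
        then show ?thesis
          using geometric[of "- s1" s0] \<open>v2 = 0\<close> \<open>v0 = 0 \<and> v1 = 0\<close>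
          by (simp add: v1_def v2_def algebra_simps)
      qed
    next
      case False
      then show ?thesis using geometric[of v0 v1] v True by simp
    qed
  next
    case False
    define p0 p1 where "p0 = v0 / v2" and "p1 = v1 / v2"
    have rec: "z = - p0 * x - p1 * y" if "v0 * x + v1 * y + v2 * z = 0" for x y z
    proof -
      have "v2 * z = - v0 * x - v1 * y" using that by (simp add: algebra_simps add_eq_0_iff)
      then have "z = (- v0 * x - v1 * y) / v2" using False by (simp add: field_simps)
      then show ?thesis by (simp add: p0_def p1_def diff_divide_distrib)
    qed
    note s2 = rec[OF v(1)] and s3 = rec[OF v(2)] and s4 = rec[OF v(3)]
    \<comment> \<open>Division with remainder: \<open>X^3 + a X^2 + b X - 1 = (X + c) (X^2 + p1 X +
      p0) + c1 X + c0\<close>.\<close>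
    define c where "c = a - p1"
    define c0 where "c0 = - 1 - c * p0"
    define c1 where "c1 = b - p0 - c * p1"
    have "c0 * x + c1 * y = 0"
      if "w = x - b * y - a * z" "z = - p0 * x - p1 * y" "w = - p0 * y - p1 * z" for x y z w
    proof -
      have "x - b * y - a * z = - p0 * y - p1 * z" using that(1,3) by simp
      then show ?thesis unfolding that(2) by (simp add: c0_def c1_def c_def algebra_simps)
    qed
    note lin = this
    have 1: "c0 * s0 + c1 * s1 = 0" using lin[OF s3_def s2 s3] .
    have 2: "c0 * s1 + c1 * s2 = 0" using lin[OF s4_def s3 s4] .
    have 3: "c0 * s2 + c1 * s3 = 0"
    proof -
      have "c0 * s2 + c1 * s3 = - p0 * (c0 * s0 + c1 * s1) - p1 * (c0 * s1 + c1 * s2)"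
        by (subst s3, subst s2) (simp add: algebra_simps)
      then show ?thesis by (simp only: 1 2) simp
    qed
    have "c0 \<noteq> 0 \<or> c1 \<noteq> 0"
    proof (rule ccontr)
      assume "\<not> ?thesis"
      then have "- 1 = c * p0" "b - p0 = c * p1" by (simp_all add: c0_def c1_def)
      then have p0: "c * p0 = - 1" and b: "b = p0 + c * p1"
        by (simp_all add: diff_eq_eq add.commute)
      have a: "a = c + p1" by (simp add: c_def)
      have "(- c) ^ 3 + a * (- c)\<^sup>2 + b * (- c) - 1 = - (c * p0) - 1"
        unfolding a b by (simp add: algebra_simps power2_eq_square power3_eq_cube)
      then show False using root[of "- c"] p0 by simp
    qed
    with geometric 1 2 3 show ?thesis by blast
  qed
qed

section \<open>Descent modulo a prime\<close>

lemma hankel_hom: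
  fixes h :: "'a::comm_ring_1 \<Rightarrow> 'b::comm_ring_1"
  assumes "\<And>x y. h (x + y) = h x + h y" "\<And>x y. h (x * y) = h x * h y" "\<And>x y. h (x - y) = h x - h y"
  shows "h (hankel a b x y z) = hankel (h a) (h b) (h x) (h y) (h z)"
  by (simp add: hankel_def Let_def assms)

lemma hankel_scale: "hankel a b (c * x) (c * y) (c * z) = c ^ 3 * hankel a b x y z"
  by (simp add: hankel_def Let_def algebra_simps power3_eq_cube)

text \<open>Isolates what the descent uses: a residue map with kernel generated by \<open>p\<close>,
  and no nonzero element divisible by all powers of \<open>p\<close>. Both the integers and the
  p-adic integers are instances.\<close>

locale discrete_valuation_residue =
  fixes p :: "'r::idom" and res :: "'r \<Rightarrow> 'f::field"
  assumes res_add: "res (x + y) = res x + res y"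
    and res_mult: "res (x * y) = res x * res y"
    and res_eq_0_iff: "res x = 0 \<longleftrightarrow> p dvd x"
    and separated: "(\<And>n. p ^ n dvd x) \<Longrightarrow> x = 0"
    and p_nonzero: "p \<noteq> 0"
begin

lemma res_diff: "res (x - y) = res x - res y"
  using res_add[of "x - y" y] by simp

text \<open>Modulo \<open>p\<close> the equation gives \<open>t = p * t'\<close>, so
  \<open>p * p\<close> divides the Hankel determinant; its anisotropy over the residue field makes
  \<open>x\<close>, \<open>y\<close>, \<open>z\<close> divisible by \<open>p\<close>. Both sides are
  homogeneous of degree 3, so the common factor cancels.\<close>

lemma hankel_descent:
  assumes root: "\<And>r. r ^ 3 + res a * r\<^sup>2 + res b * r - 1 \<noteq> 0"
    and eq: "p * hankel a b x y z = t ^ 3"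
  shows "\<exists>x' y' z' t'. x = p * x' \<and> y = p * y' \<and> z = p * z' \<and> t = p * t' \<and>
    p * hankel a b x' y' z' = t' ^ 3"
proof -
  have res_p: "res p = 0" by (simp add: res_eq_0_iff)
  have "res (p * hankel a b x y z) = res (t * t * t)" by (simp add: eq power3_eq_cube)
  then have "res t = 0" by (simp add: res_mult res_p)
  then obtain t' where t': "t = p * t'" by (auto simp: res_eq_0_iff)
  have "p * hankel a b x y z = p * (p * p * t' ^ 3)"
    by (simp add: eq t' power3_eq_cube)
  then have h: "hankel a b x y z = p * p * t' ^ 3" using p_nonzero by simp
  then have "hankel (res a) (res b) (res x) (res y) (res z) = res (p * p * t' ^ 3)"
    using hankel_hom[of res, OF res_add res_mult res_diff] by metis
  then have "hankel (res a) (res b) (res x) (res y) (res z) = 0"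
    by (simp add: res_mult res_p)
  from hankel_anisotropic[OF root this] obtain x' y' z' where
    xyz: "x = p * x'" "y = p * y'" "z = p * z'" by (auto simp: res_eq_0_iff elim!: dvdE)
  have "p * p * (p * hankel a b x' y' z') = p * p * t' ^ 3"
    using h unfolding xyz hankel_scale by (simp add: power3_eq_cube mult.assoc)
  then have "p * hankel a b x' y' z' = t' ^ 3" using p_nonzero by simp
  then show ?thesis using xyz t' by blast
qed

text \<open>The descent repeats, so every power of \<open>p\<close> divides \<open>x\<close> and
  \<open>t\<close>. In terms of valuations, nonzero Hankel determinants have valuation divisible by
  3, hence \<open>p\<close> times one is never a cube.\<close>

lemma hankel_trivial:
  assumes root: "\<And>r. r ^ 3 + res a * r\<^sup>2 + res b * r - 1 \<noteq> 0"
    and eq: "p * hankel a b x y z = t ^ 3"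
  shows "x = 0 \<and> t = 0"
proof -
  have "p ^ n dvd x \<and> p ^ n dvd t" for n
    using eq
  proof (induction n arbitrary: x y z t)
    case (Suc n)
    from hankel_descent[OF root Suc.prems] Suc.IH show ?case by (metis mult_dvd_mono dvd_refl power_Suc)
  qed simp
  then show ?thesis using separated by blast
qed

text \<open>Clearing denominators with \<open>d\<close> turns - 1 into the cube of
  \<open>- d\<close> and 0 into the cube of 0; then \<open>hankel_trivial\<close> applies.\<close>

lemma fraction_hankel_neq:
  fixes \<iota> :: "'r \<Rightarrow> 'k::field"
  assumes root: "\<And>r. r ^ 3 + res a * r\<^sup>2 + res b * r - 1 \<noteq> 0"
    and hom: "\<And>x y. \<iota> (x + y) = \<iota> x + \<iota> y" "\<And>x y. \<iota> (x * y) = \<iota> x * \<iota> y"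
    and inj: "inj \<iota>"
    and fraction: "\<And>s. \<exists>x y. y \<noteq> 0 \<and> s * \<iota> y = \<iota> x"
  shows "\<iota> p * hankel (\<iota> a) (\<iota> b) s0 s1 s2 \<noteq> - 1" "s0 \<noteq> 0 \<Longrightarrow> hankel (\<iota> a) (\<iota> b) s0 s1 s2 \<noteq> 0"
proof -
  have \<iota>_diff: "\<iota> (x - y) = \<iota> x - \<iota> y" for x y using hom(1)[of "x - y" y] by simp
  have \<iota>_0: "\<iota> 0 = 0" using \<iota>_diff[of 0 0] by simp
  have \<iota>_eq_0: "\<iota> x = 0 \<longleftrightarrow> x = 0" for x using inj \<iota>_0 by (metis injD)
  obtain x0 d0 x1 d1 x2 d2 where d: "d0 \<noteq> 0" "s0 * \<iota> d0 = \<iota> x0" "d1 \<noteq> 0" "s1 * \<iota> d1 = \<iota> x1"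
    "d2 \<noteq> 0" "s2 * \<iota> d2 = \<iota> x2"
    using fraction by metis
  define d where "d = d0 * d1 * d2"
  have "d \<noteq> 0" using d by (simp add: d_def)
  define x y z where "x = x0 * d1 * d2" and "y = x1 * d0 * d2" and "z = x2 * d0 * d1"
  have xyz: "\<iota> d * s0 = \<iota> x" "\<iota> d * s1 = \<iota> y" "\<iota> d * s2 = \<iota> z"
    by (simp_all add: d_def x_def y_def z_def hom d(2,4,6)[symmetric])
  have "\<iota> d ^ 3 * hankel (\<iota> a) (\<iota> b) s0 s1 s2 = \<iota> (hankel a b x y z)"
    by (simp add: hankel_hom[of \<iota>, OF hom \<iota>_diff] xyz flip: hankel_scale)
  then have key: "\<iota> (p * hankel a b x y z) = \<iota> (d * d * d) * (\<iota> p * hankel (\<iota> a) (\<iota> b) s0 s1 s2)"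
    by (simp add: hom power3_eq_cube mult_ac)
  show "\<iota> p * hankel (\<iota> a) (\<iota> b) s0 s1 s2 \<noteq> - 1"
  proof
    assume "\<iota> p * hankel (\<iota> a) (\<iota> b) s0 s1 s2 = - 1"
    then have "\<iota> (p * hankel a b x y z) = \<iota> (0 - d * d * d)"
      using key unfolding \<iota>_diff by (simp add: \<iota>_0)
    then have "p * hankel a b x y z = 0 - d * d * d" using inj by (metis injD)
    then have "p * hankel a b x y z = (- d) ^ 3" by (simp add: power3_eq_cube)
    from hankel_trivial[OF root this] show False using \<open>d \<noteq> 0\<close> by simp
  qed
  assume "s0 \<noteq> 0"
  show "hankel (\<iota> a) (\<iota> b) s0 s1 s2 \<noteq> 0"
  proof
    assume "hankel (\<iota> a) (\<iota> b) s0 s1 s2 = 0"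
    then have "p * hankel a b x y z = 0 ^ 3" using key \<iota>_eq_0 by simp
    from hankel_trivial[OF root this] have "x = 0" by simp
    then have "\<iota> d * s0 = 0" using xyz \<iota>_0 by simp
    then show False using \<open>s0 \<noteq> 0\<close> \<open>d \<noteq> 0\<close> \<iota>_eq_0 by simp
  qed
qed

text \<open>A root \<open>r\<close> makes the geometric sequence 1, \<open>r\<close>,
  \<open>r^2\<close>, ... satisfy the recurrence; its Hankel matrix has rank one, against
  anisotropy.\<close>

lemma fraction_no_root:
  fixes \<iota> :: "'r \<Rightarrow> 'k::field"
  assumes root: "\<And>r. r ^ 3 + res a * r\<^sup>2 + res b * r - 1 \<noteq> 0"
    and hom: "\<And>x y. \<iota> (x + y) = \<iota> x + \<iota> y" "\<And>x y. \<iota> (x * y) = \<iota> x * \<iota> y"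
    and inj: "inj \<iota>"
    and fraction: "\<And>s. \<exists>x y. y \<noteq> 0 \<and> s * \<iota> y = \<iota> x"
  shows "r ^ 3 + \<iota> a * r\<^sup>2 + \<iota> b * r - 1 \<noteq> 0"
proof
  assume "r ^ 3 + \<iota> a * r\<^sup>2 + \<iota> b * r - 1 = 0"
  then have "1 - \<iota> b * r - \<iota> a * r\<^sup>2 = r ^ 3" by (simp add: algebra_simps)
  then have "hankel (\<iota> a) (\<iota> b) 1 r (r\<^sup>2)
      = r\<^sup>2 * (r - \<iota> b * r\<^sup>2 - \<iota> a * r ^ 3) - r ^ 3 * r ^ 3
        - r * (r * (r - \<iota> b * r\<^sup>2 - \<iota> a * r ^ 3) - r\<^sup>2 * r ^ 3) + r\<^sup>2 * (r * r ^ 3 - r\<^sup>2 * r\<^sup>2)"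
    by (simp add: hankel_def Let_def)
  also have "\<dots> = 0" by (simp add: algebra_simps power2_eq_square power3_eq_cube)
  finally show False using fraction_hankel_neq(2)[OF assms, of 1 r "r\<^sup>2"] by simp
qed

end

section \<open>Residue fields\<close>

text \<open>A root \<open>r\<close> is nonzero and, together with \<open>a\<close>, determines
  \<open>b\<close>. In a field of \<open>n\<close> elements, at most \<open>(n - 1) n\<close> of the
  \<open>n^2\<close> pairs \<open>(a, b)\<close> therefore admit a root.\<close>

lemma finite_field_cubic_without_root:
  "\<exists>a b :: 'f::{field, finite}. \<forall>r. r ^ 3 + a * r\<^sup>2 + b * r - 1 \<noteq> 0"
proof (rule ccontr)
  assume "\<not> ?thesis"
  then have root: "\<exists>r :: 'f. r ^ 3 + a * r\<^sup>2 + b * r - 1 = 0" for a b by blast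
  define g :: "'f \<times> 'f \<Rightarrow> 'f \<times> 'f" where "g = (\<lambda>(r, a). (a, (1 - r ^ 3 - a * r\<^sup>2) / r))"
  have "(a, b) \<in> g ` ((UNIV - {0}) \<times> UNIV)" for a b
  proof -
    obtain r where r: "r ^ 3 + a * r\<^sup>2 + b * r - 1 = 0" using root by blast
    then have "r \<noteq> 0" by auto
    moreover have "b * r = 1 - r ^ 3 - a * r\<^sup>2" using r by (simp add: algebra_simps)
    ultimately have "g (r, a) = (a, b)" by (simp add: g_def flip: \<open>b * r = _\<close>)
    then show ?thesis using \<open>r \<noteq> 0\<close> by (intro image_eqI[of _ _ "(r, a)"]) auto
  qed
  then have "(UNIV :: ('f \<times> 'f) set) \<subseteq> g ` ((UNIV - {0}) \<times> UNIV)" by auto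
  then have "card (UNIV :: ('f \<times> 'f) set) \<le> card ((UNIV - {0 :: 'f}) \<times> (UNIV :: 'f set))"
    by (rule surj_card_le[rotated]) simp
  also have "\<dots> = (CARD('f) - 1) * CARD('f)" by (simp add: card_cartesian_product)
  also have "\<dots> < CARD('f) * CARD('f)" using finite_UNIV_card_ge_0[where 'a = 'f] by simp
  finally show False by simp
qed

lemma of_int_mod_ring_eq_0_iff:
  "(of_int n :: 'p::prime_card mod_ring) = 0 \<longleftrightarrow> int CARD('p) dvd n"
  unfolding of_int_of_int_mod_ring by transfer (simp add: dvd_eq_mod_eq_0)

lemma int_eq_0_if_powers_dvd:
  fixes x :: int
  assumes "p > 1" "\<And>n. p ^ n dvd x"
  shows "x = 0"
proof (rule ccontr)
  assume "x \<noteq> 0"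
  define n where "n = nat \<bar>x\<bar>"
  have "int n < 2 ^ n" by (rule of_nat_less_two_power)
  also have "\<dots> \<le> p ^ n" using assms(1) by (intro power_mono) auto
  also have "\<dots> \<le> \<bar>x\<bar>"
    using dvd_imp_le_int[OF \<open>x \<noteq> 0\<close> assms(2)[of n]] assms(1) by simp
  finally show False by (simp add: n_def)
qed

lemma discrete_valuation_residue_int:
  "discrete_valuation_residue (int CARD('p)) (of_int :: int \<Rightarrow> 'p::prime_card mod_ring)"
proof
  fix x :: int assume "\<And>n. int CARD('p) ^ n dvd x"
  then show "x = 0"
    using CARD_prime_card_gt_1[where 'p = 'p] by (intro int_eq_0_if_powers_dvd[of "int CARD('p)"]) simp_all
qed (simp_all add: of_int_mod_ring_eq_0_iff)

section \<open>Divisibility by p and residues of p-adic integers\<close>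

abbreviation padic_component :: "'p::prime_card padic_int \<Rightarrow> nat \<Rightarrow> int" where
  "padic_component \<equiv> Rep_padic_int"

lemma padic_component_of_nat:
  "padic_component (of_nat m :: 'p::prime_card padic_int) n = int m mod int CARD('p) ^ n"
  by (induction m) (simp_all add: zero_padic_int.rep_eq one_padic_int.rep_eq plus_padic_int.rep_eq mod_simps add.commute)

lemma padic_component_mod: "padic_component x (Suc n) mod int CARD('p) ^ n = padic_component (x :: 'p::prime_card padic_int) n"
  using Rep_padic_int[of x] by simp

lemma padic_component_mod_1:
  "padic_component x (Suc n) mod int CARD('p) = padic_component (x :: 'p::prime_card padic_int) 1"
proof (induction n)
  case 0
  then show ?case
    using compatible_imp_reduced[of "padic_component x" "int CARD('p)" 1] padic_component_mod[of x] by simp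
next
  case (Suc n)
  have "padic_component x (Suc (Suc n)) mod int CARD('p)
      = padic_component x (Suc (Suc n)) mod int CARD('p) ^ Suc n mod int CARD('p)"
    by (rule mod_mod_cancel[symmetric]) simp
  then show ?case using Suc by (simp only: padic_component_mod)
qed

lemma of_nat_padic_int_dvd_iff:
  fixes x :: "'p::prime_card padic_int"
  shows "of_nat CARD('p) dvd x \<longleftrightarrow> int CARD('p) dvd padic_component x 1"
proof
  assume "of_nat CARD('p) dvd x"
  then obtain y where "x = of_nat CARD('p) * y" by (rule dvdE)
  then show "int CARD('p) dvd padic_component x 1"
    by (simp add: times_padic_int.rep_eq padic_component_of_nat)
next
  assume dvd: "int CARD('p) dvd padic_component x 1"
  let ?p = "int CARD('p)"
  \<comment> \<open>Division by \<open>p\<close> loses one digit of precision, so the quotient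
    modulo \<open>p^n\<close> is taken from the component at \<open>Suc n\<close>.\<close>
  define y :: "'p padic_int" where "y = Abs_padic_int (\<lambda>n. padic_component x (Suc n) div ?p)"
  have "padic_component x (Suc (Suc n)) div ?p mod ?p ^ n = padic_component x (Suc n) div ?p" for n
  proof -
    have "padic_component x (Suc (Suc n)) mod (?p * ?p ^ n)
        = ?p * (padic_component x (Suc (Suc n)) div ?p mod ?p ^ n) + padic_component x (Suc (Suc n)) mod ?p"
      by (rule zmod_zmult2_eq) simp
    moreover have "padic_component x (Suc (Suc n)) mod (?p * ?p ^ n) = padic_component x (Suc n)"
      using padic_component_mod[of x "Suc n"] by simp
    moreover have "padic_component x (Suc (Suc n)) mod ?p = 0"
      using padic_component_mod_1[of x "Suc n"] dvd by (metis dvd_imp_mod_0 mod_mod_trivial)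
    ultimately show ?thesis
      using CARD_prime_card_gt_1[where 'p = 'p] by simp
  qed
  then have y: "padic_component y n = padic_component x (Suc n) div ?p" for n
    unfolding y_def by (subst Abs_padic_int_inverse) auto
  have "x = of_nat CARD('p) * y"
  proof (rule Rep_padic_int_inject[THEN iffD1], rule ext)
    fix n
    have "?p dvd padic_component x (Suc n)"
      using dvd padic_component_mod_1[of x n] compatible_imp_reduced[of "padic_component x" ?p 1] padic_component_mod[of x]
      by (metis dvd_mod_iff dvd_refl)
    then have "?p * padic_component y n = padic_component x (Suc n)" by (simp add: y)
    then show "padic_component x n = padic_component (of_nat CARD('p) * y) n"
      by (simp add: times_padic_int.rep_eq padic_component_of_nat mod_mult_left_eq padic_component_mod)
  qed
  then show "of_nat CARD('p) dvd x" by (rule dvdI)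
qed

text \<open>Characteristic zero: it supplies that \<open>p\<close>, 2 and 3 are nonzero.\<close>

lemma of_nat_padic_int_eq_0_iff: "(of_nat m :: 'p::prime_card padic_int) = 0 \<longleftrightarrow> m = 0"
proof
  assume "(of_nat m :: 'p padic_int) = 0"
  then have "int m mod int CARD('p) ^ n = 0" for n
    by (simp add: zero_padic_int.rep_eq flip: padic_component_of_nat)
  then have "int CARD('p) ^ n dvd int m" for n by (simp only: dvd_eq_mod_eq_0)
  then show "m = 0"
    using int_eq_0_if_powers_dvd[of "int CARD('p)" "int m"] CARD_prime_card_gt_1[where 'p = 'p] by simp
qed simp

lemma of_int_mod_CARD: "of_int (n mod int CARD('p)) = (of_int n :: 'p::prime_card mod_ring)"
  using of_int_mod_CHAR[of n, where 'a = "'p mod_ring"] by simp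

lemma discrete_valuation_residue_padic_int:
  "discrete_valuation_residue (of_nat CARD('p))
    (\<lambda>x :: 'p::prime_card padic_int. of_int (padic_component x 1) :: 'p mod_ring)"
proof
  fix x y :: "'p padic_int"
  show "(of_int (padic_component (x + y) 1) :: 'p mod_ring)
      = of_int (padic_component x 1) + of_int (padic_component y 1)"
    by (simp add: plus_padic_int.rep_eq of_int_mod_CARD)
  show "(of_int (padic_component (x * y) 1) :: 'p mod_ring)
      = of_int (padic_component x 1) * of_int (padic_component y 1)"
    by (simp add: times_padic_int.rep_eq of_int_mod_CARD)
  show "(of_int (padic_component x 1) :: 'p mod_ring) = 0 \<longleftrightarrow> of_nat CARD('p) dvd x"
    by (simp only: of_int_mod_ring_eq_0_iff of_nat_padic_int_dvd_iff)
  show "of_nat CARD('p) \<noteq> (0 :: 'p padic_int)" by (simp add: of_nat_padic_int_eq_0_iff)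
  assume dvd: "\<And>n. of_nat CARD('p) ^ n dvd x"
  have "padic_component x n = 0" for n
  proof -
    have "padic_component (of_nat CARD('p) ^ n :: 'p padic_int) n = 0"
      using padic_component_of_nat[of "CARD('p) ^ n" n, where 'p = 'p] by simp
    moreover obtain z where "x = of_nat CARD('p) ^ n * z" using dvd[of n] by (rule dvdE)
    ultimately show ?thesis by (simp add: times_padic_int.rep_eq)
  qed
  then show "x = 0" by (simp add: zero_padic_int.rep_eq fun_eq_iff flip: Rep_padic_int_inject)
qed

section \<open>Semisimplicity\<close>

text \<open>A basis extracted from \<open>set bs\<close> has as many elements as the list has
  entries, so it is the whole set and the list has no repetitions.\<close>

lemma (in vector_space) basis_list_if_spanning:
  assumes "span (set bs) = UNIV" "length bs = dim UNIV"
  shows "basis_list scale bs"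
proof -
  obtain A where A: "A \<subseteq> set bs" "independent A" "set bs \<subseteq> span A"
    by (rule maximal_independent_subset)
  then have "span A = UNIV" using assms(1) by (metis span_mono span_span top.extremum_uniqueI)
  then have "card A = dim (UNIV :: 'b set)" using A(2) dim_eq_card[of A UNIV] by simp
  then have "card A = length bs" using assms(2) by simp
  moreover have "card A \<le> card (set bs)" using A(1) by (simp add: card_mono)
  ultimately have "card (set bs) = length bs" "card A = card (set bs)"
    using card_length[of bs] by simp_all
  then have "distinct bs" "A = set bs"
    using A(1) by (simp_all add: card_distinct card_subset_eq)
  then show ?thesis using A(2) assms(1) by (simp add: basis_list_def)
qed

lemma (in vector_space) representation_basis_list:
  assumes bs: "basis_list scale bs" and j: "j < length bs"
    and x: "x = (\<Sum>i<length bs. scale (c i) (bs ! i))"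
  shows "representation (set bs) x (bs ! j) = c j"
proof -
  have ind: "independent (set bs)" and span: "span (set bs) = UNIV" and dist: "distinct bs"
    using bs by (auto simp: basis_list_def)
  have "representation (set bs) x (bs ! j)
      = (\<Sum>i<length bs. representation (set bs) (scale (c i) (bs ! i)) (bs ! j))"
    unfolding x by (subst representation_sum) (auto simp: ind span)
  also have "\<dots> = (\<Sum>i<length bs. if i = j then c i else 0)"
    using dist j
    by (intro sum.cong) (auto simp: representation_scale ind span representation_basis nth_eq_iff_index_eq)
  also have "\<dots> = c j" using j by simp
  finally show ?thesis .
qed

section \<open>The matrix of the cubic element in standard coordinates\<close>

fun zorn_list :: "'k zorn \<Rightarrow> 'k list" where
  "zorn_list (x, y, v1, v2, v3, w1, w2, w3) = [x, y, v1, v2, v3, w1, w2, w3]"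

definition zorn_basis :: "'k::field zorn list" where
  "zorn_basis = [(1,0,0,0,0,0,0,0), (0,1,0,0,0,0,0,0), (0,0,1,0,0,0,0,0), (0,0,0,1,0,0,0,0),
    (0,0,0,0,1,0,0,0), (0,0,0,0,0,1,0,0), (0,0,0,0,0,0,1,0), (0,0,0,0,0,0,0,1)]"

lemma sum_lessThan_8: "(\<Sum>i<8. f i) = f 0 + f 1 + f 2 + f 3 + f 4 + f 5 + f 6 + f (7::nat)"
  by (simp add: eval_nat_numeral)

lemma nth_8:
  "[x0,x1,x2,x3,x4,x5,x6,x7] ! 0 = x0" "[x0,x1,x2,x3,x4,x5,x6,x7] ! 1 = x1"
  "[x0,x1,x2,x3,x4,x5,x6,x7] ! 2 = x2" "[x0,x1,x2,x3,x4,x5,x6,x7] ! 3 = x3"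
  "[x0,x1,x2,x3,x4,x5,x6,x7] ! 4 = x4" "[x0,x1,x2,x3,x4,x5,x6,x7] ! 5 = x5"
  "[x0,x1,x2,x3,x4,x5,x6,x7] ! 6 = x6" "[x0,x1,x2,x3,x4,x5,x6,x7] ! 7 = x7"
  by simp_all

lemma less_8_cases:
  assumes "(i::nat) < 8" "P 0" "P 1" "P 2" "P 3" "P 4" "P 5" "P 6" "P 7"
  shows "P i"
proof -
  have "i = 0 \<or> i = 1 \<or> i = 2 \<or> i = 3 \<or> i = 4 \<or> i = 5 \<or> i = 6 \<or> i = 7" using assms(1) by linarith
  then show ?thesis using assms by blast
qed

lemma zorn_list_sum: "s = (\<Sum>i<8. zorn_scale (zorn_list s ! i) (zorn_basis ! i))"
  by (cases s rule: zorn_cases) (simp add: sum_lessThan_8 nth_8 zorn_basis_def)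

definition zorn_cubic_mat :: "'k::field \<Rightarrow> 'k \<Rightarrow> 'k \<Rightarrow> 'k mat" where
  "zorn_cubic_mat a b q = mat 8 8 (\<lambda>(i, j). zorn_list (zorn_cubic a b q (zorn_basis ! j)) ! i)"

lemma zorn_cubic_mat_mult:
  assumes "i < 8"
  shows "(\<Sum>k<8. zorn_cubic_mat a b q $$ (i, k) * zorn_list s ! k) = zorn_list (zorn_cubic a b q s) ! i"
  by (rule less_8_cases[OF assms]; cases s rule: zorn_cases)
    (simp_all add: sum_lessThan_8 nth_8 zorn_basis_def zorn_cubic_mat_def algebra_simps)

lemma map_mat_zorn_cubic_mat:
  "map_mat to_ac (zorn_cubic_mat a b q) = zorn_cubic_mat (to_ac a) (to_ac b) (to_ac q)"
proof (rule eq_matI)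
  fix i j assume "i < dim_row (zorn_cubic_mat (to_ac a) (to_ac b) (to_ac q))"
    "j < dim_col (zorn_cubic_mat (to_ac a) (to_ac b) (to_ac q))"
  then have "i < 8" "j < 8" by (simp_all add: zorn_cubic_mat_def)
  then show "map_mat to_ac (zorn_cubic_mat a b q) $$ (i, j)
      = zorn_cubic_mat (to_ac a) (to_ac b) (to_ac q) $$ (i, j)"
    by (elim less_8_cases[where i = i]; elim less_8_cases[where i = j])
      (simp_all add: zorn_cubic_mat_def zorn_basis_def nth_8)
qed (simp_all add: zorn_cubic_mat_def)

section \<open>Roots of the cubic and diagonalization\<close>

lemma cubic_roots:
  fixes a b :: "'k::alg_closed_field"
  obtains r1 r2 r3 where "a = - (r1 + r2 + r3)" "b = r1 * r2 + r1 * r3 + r2 * r3" "r1 * r2 * r3 = 1"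
proof -
  have "\<exists>x. poly [:- 1, b, a, 1:] x = 0" by (rule alg_closed_imp_poly_has_root) simp
  then obtain r1 where r1: "poly [:- 1, b, a, 1:] r1 = 0" ..
  \<comment> \<open>This is the quotient of the cubic by \<open>X - r1\<close>; the third root is
    then read off from the sum of the roots.\<close>
  have "\<exists>x. poly [:b + r1 * (a + r1), a + r1, 1:] x = 0"
    by (rule alg_closed_imp_poly_has_root) simp
  then obtain r2 where r2: "b + r1 * (a + r1) + r2 * (a + r1 + r2) = 0" by auto
  define r3 where "r3 = - a - r1 - r2"
  have a: "a = - (r1 + r2 + r3)" by (simp add: r3_def)
  have b: "b = r1 * r2 + r1 * r3 + r2 * r3" using r2 unfolding a by (simp add: algebra_simps add_eq_0_iff)
  have "r1 * r2 * r3 = 1" using r1 unfolding a b by (simp add: algebra_simps)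
  with a b that show ?thesis by blast
qed

text \<open>A multiple root would already lie in the base field: it is \<open>- a / 3\<close> if
  triple, and otherwise the zero of the linear remainder of the cubic modulo its derivative. Here 2
  and 3 must be nonzero.\<close>

lemma cubic_double_root:
  fixes a b :: "'k::field"
  assumes root: "\<And>r. r ^ 3 + a * r\<^sup>2 + b * r - 1 \<noteq> 0" and char: "(2::'k) \<noteq> 0" "(3::'k) \<noteq> 0"
    and vieta: "to_ac a = - (r + r + s)" "to_ac b = r * r + r * s + r * s" "r * r * s = 1"
  shows False
proof -
  have vanish: "r ^ 3 + to_ac a * r\<^sup>2 + to_ac b * r - 1 = 0"
    unfolding vieta(1,2) using vieta(3) by (simp add: algebra_simps power2_eq_square power3_eq_cube)
  have "r \<in> range to_ac"
  proof (cases "r = s")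
    case True
    then have "to_ac a = - (to_ac 3 * r)" using vieta(1) by simp
    then have "r = to_ac (- a / 3)" using char to_ac_eq_0_iff[of "3::'k"] by (simp add: field_simps)
    then show ?thesis by blast
  next
    case False
    have "to_ac (6 * b - 2 * a * a) = - to_ac 2 * (r - s) * (r - s)"
      by (simp add: vieta(1,2) algebra_simps)
    then have nz: "to_ac (6 * b - 2 * a * a) \<noteq> 0"
      using False char to_ac_eq_0_iff[of "2::'k"] by simp
    \<comment> \<open>This is \<open>9 f = (3 X + a) f' + (6 b - 2 a^2) X - (9 + a b)\<close> at the
      common zero of \<open>f\<close> and its derivative \<open>f'\<close>.\<close>
    have "to_ac (6 * b - 2 * a * a) * r = 9 * (r * r * s) + to_ac (a * b)"
      by (simp add: vieta(1,2) algebra_simps)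
    also have "\<dots> = to_ac (9 + a * b)" by (simp add: vieta(3))
    finally have "r = to_ac ((9 + a * b) / (6 * b - 2 * a * a))"
      using nz by (simp only: to_ac_divide) (simp add: field_simps)
    then show ?thesis by blast
  qed
  then obtain t where "r = to_ac t" by blast
  with vanish have "to_ac (t ^ 3 + a * t\<^sup>2 + b * t - 1) = 0" by simp
  then show False using root by (simp only: to_ac_eq_0_iff)
qed

lemma similar_diagonal_if_eigenbasis:
  fixes M :: "'k::field mat"
  assumes M: "M \<in> carrier_mat n n" and P: "P \<in> carrier_mat n n" and Q: "Q \<in> carrier_mat n n"
    and QP: "Q * P = 1\<^sub>m n" and D: "D \<in> carrier_mat n n" and MP: "M * P = P * D"
  shows "similar_mat M D"
proof -
  have PQ: "P * Q = 1\<^sub>m n" using mat_mult_left_right_inverse[OF Q P QP] .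
  have "P * D * Q = M * P * Q" by (simp add: MP)
  also have "\<dots> = M * (P * Q)" using M P Q by (rule assoc_mult_mat)
  also have "\<dots> = M" using M by (simp add: PQ)
  finally have "similar_mat_wit M D P Q" using M P Q D PQ QP by (intro similar_mat_witI) simp_all
  then show ?thesis by (auto simp: similar_mat_def)
qed

text \<open>
  The columns of \<open>P\<close> are eigenvectors of the matrix, the rows of \<open>Q\<close> are eigenvectors of its
  transpose, rescaled by the derivatives of the cubic at its roots.
\<close>

lemma zorn_cubic_mat_diagonalizable:
  fixes a b q :: "'k::field"
  assumes q: "q \<noteq> 0"
    and vieta: "a = - (r1 + r2 + r3)" "b = r1 * r2 + r1 * r3 + r2 * r3" "r1 * r2 * r3 = 1"
    and distinct: "r1 \<noteq> r2" "r1 \<noteq> r3" "r2 \<noteq> r3"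
  shows "\<exists>D. diagonal_mat D \<and> similar_mat (zorn_cubic_mat a b q) D"
proof -
  define P where "P = ([(1,0,0,0,0,0,0,0), (0,1,0,0,0,0,0,0),
      (0,0,q*(r2*r3),-(r2+r3),1,0,0,0), (0,0,q*(r1*r3),-(r1+r3),1,0,0,0), (0,0,q*(r1*r2),-(r1+r2),1,0,0,0),
      (0,0,0,0,0,1,q*r1,q*r1\<^sup>2), (0,0,0,0,0,1,q*r2,q*r2\<^sup>2), (0,0,0,0,0,1,q*r3,q*r3\<^sup>2)] :: 'k zorn list)"
  define d1 d2 d3 where "d1 = q * ((r1 - r2) * (r1 - r3))" and "d2 = q * ((r2 - r1) * (r2 - r3))"
    and "d3 = q * ((r3 - r1) * (r3 - r2))"
  have d: "d1 \<noteq> 0" "d2 \<noteq> 0" "d3 \<noteq> 0" using q distinct by (auto simp: d1_def d2_def d3_def)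
  define Q where "Q = ([(1,0,0,0,0,0,0,0), (0,1,0,0,0,0,0,0),
      zorn_scale (1/d1) (0,0,1,q*r1,q*r1\<^sup>2,0,0,0), zorn_scale (1/d2) (0,0,1,q*r2,q*r2\<^sup>2,0,0,0),
      zorn_scale (1/d3) (0,0,1,q*r3,q*r3\<^sup>2,0,0,0),
      zorn_scale (1/d1) (0,0,0,0,0,q*(r2*r3),-(r2+r3),1), zorn_scale (1/d2) (0,0,0,0,0,q*(r1*r3),-(r1+r3),1),
      zorn_scale (1/d3) (0,0,0,0,0,q*(r1*r2),-(r1+r2),1)] :: 'k zorn list)"
  \<comment> \<open>The eigenvalues on the \<open>w\<close> part are the inverses of the roots,
    written as products by means of \<open>r1 * r2 * r3 = 1\<close>.\<close>
  define E where "E = [1, 1, r1, r2, r3, r2*r3, r1*r3, r1*r2]"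
  define Pm where "Pm = mat 8 8 (\<lambda>(i, j). zorn_list (P ! j) ! i)"
  define Qm where "Qm = mat 8 8 (\<lambda>(i, j). zorn_list (Q ! i) ! j)"
  define Dm where "Dm = mat 8 8 (\<lambda>(i, j). if i = j then E ! j else 0)"
  have prod_eq: "S * T = R" if "S \<in> carrier_mat 8 8" "T \<in> carrier_mat 8 8" "R \<in> carrier_mat 8 8"
    "\<And>i j. i < 8 \<Longrightarrow> j < 8 \<Longrightarrow> (\<Sum>k<8. S $$ (i, k) * T $$ (k, j)) = R $$ (i, j)" for S T R :: "'k mat"
    using that by (intro eq_matI) (auto simp: scalar_prod_def lessThan_atLeast0)
  have eigen: "zorn_cubic a b q (P ! j) = zorn_scale (E ! j) (P ! j)" if "j < 8" for j
  proof -
    have vieta': "r1 * (r2 * r3) = 1" "r2 * (r1 * r3) = 1" "r3 * (r1 * r2) = 1"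
      using vieta(3) by (simp_all add: mult_ac)
    show ?thesis
      by (rule less_8_cases[OF that])
        (use q vieta' in \<open>simp_all only: P_def E_def nth_8\<close>,
         simp_all add: vieta(1,2) field_simps power2_eq_square)
  qed
  have scale_nth: "zorn_list (zorn_scale c s) ! i = c * zorn_list s ! i" if "i < 8" for c i and s :: "'k zorn"
    by (rule less_8_cases[OF that]; cases s rule: zorn_cases) (simp_all add: nth_8)
  have "zorn_cubic_mat a b q * Pm = Pm * Dm"
  proof -
    define Z where "Z = mat 8 8 (\<lambda>(i, j). zorn_list (P ! j) ! i * E ! j)"
    have "zorn_cubic_mat a b q * Pm = Z"
    proof (rule prod_eq)
      fix i j :: nat assume ij: "i < 8" "j < 8"
      have "(\<Sum>k<8. zorn_cubic_mat a b q $$ (i, k) * Pm $$ (k, j))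
          = (\<Sum>k<8. zorn_cubic_mat a b q $$ (i, k) * zorn_list (P ! j) ! k)"
        using ij by (intro sum.cong) (simp_all add: Pm_def)
      then show "(\<Sum>k<8. zorn_cubic_mat a b q $$ (i, k) * Pm $$ (k, j)) = Z $$ (i, j)"
        using ij by (simp add: zorn_cubic_mat_mult eigen scale_nth Z_def)
    qed (simp_all add: zorn_cubic_mat_def Pm_def Z_def)
    moreover have "Pm * Dm = Z"
    proof (rule prod_eq)
      fix i j :: nat assume ij: "i < 8" "j < 8"
      have "(\<Sum>k<8. Pm $$ (i, k) * Dm $$ (k, j)) = (\<Sum>k<8. if k = j then Z $$ (i, j) else 0)"
        using ij by (intro sum.cong) (simp_all add: Pm_def Dm_def Z_def)
      then show "(\<Sum>k<8. Pm $$ (i, k) * Dm $$ (k, j)) = Z $$ (i, j)" using ij by simp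
    qed (simp_all add: Dm_def Pm_def Z_def)
    ultimately show ?thesis by simp
  qed
  moreover have "Qm * Pm = 1\<^sub>m 8"
  proof (rule prod_eq)
    fix i j :: nat assume ij: "i < 8" "j < 8"
    have "(\<Sum>k<8. Qm $$ (i, k) * Pm $$ (k, j)) = (\<Sum>k<8. zorn_list (Q ! i) ! k * zorn_list (P ! j) ! k)"
      using ij by (intro sum.cong) (simp_all add: Pm_def Qm_def)
    also have "\<dots> = (if i = j then 1 else 0)"
      by (rule less_8_cases[OF ij(1)]; rule less_8_cases[OF ij(2)];
          use d in \<open>simp add: sum_lessThan_8 nth_8 P_def Q_def field_simps\<close>;
          simp add: d1_def d2_def d3_def algebra_simps power2_eq_square)
    finally show "(\<Sum>k<8. Qm $$ (i, k) * Pm $$ (k, j)) = 1\<^sub>m 8 $$ (i, j)" using ij by simp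
  qed (simp_all add: Qm_def Pm_def)
  ultimately have "similar_mat (zorn_cubic_mat a b q) Dm"
    by (intro similar_diagonal_if_eigenbasis[of _ 8 Pm Qm]) (simp_all add: zorn_cubic_mat_def Pm_def Qm_def Dm_def)
  moreover have "diagonal_mat Dm" by (simp add: diagonal_mat_def Dm_def)
  ultimately show ?thesis by blast
qed

section \<open>Conjugacy\<close>

lemma (in vector_space) carrier_algebra_aut_groupI:
  assumes "\<And>x y. g (x + y) = g x + g y" "\<And>a x. g (scale a x) = scale a (g x)" "bij g"
    "\<And>x y. g (mul x y) = mul (g x) (g y)" "g unit = unit"
  shows "g \<in> carrier (algebra_aut_group scale mul unit)"
proof -
  have "Vector_Spaces.linear scale scale g" by unfold_locales (simp_all add: assms)
  then show ?thesis using assms by (simp add: algebra_aut_group_def)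
qed

text \<open>Zorn coordinates carry \<open>zorn_cubic a b q\<close> to an automorphism
  \<open>g\<close>. A conjugating \<open>h\<close>, read back in these coordinates, is an instance
  of \<open>zorn_cubic_inverting\<close>, and \<open>ex_hankel\<close> contradicts
  \<open>hankel\<close>. Semisimplicity follows from the three distinct roots.\<close>

lemma (in split_octonion_algebra) ex_semisimple_not_conjugate_inverse:
  fixes a b q :: 'a
  assumes q: "q \<noteq> 0" and char: "(2::'a) \<noteq> 0" "(3::'a) \<noteq> 0"
    and root: "\<And>r. r ^ 3 + a * r\<^sup>2 + b * r - 1 \<noteq> 0"
    and hankel: "\<And>s0 s1 s2. q * hankel a b s0 s1 s2 \<noteq> - 1"
  defines "G \<equiv> algebra_aut_group scale mul unit"
  shows "\<exists>g \<in> carrier G. semisimple scale g \<and> \<not> conjugate_in G g (inv\<^bsub>G\<^esub> g)"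
proof -
  obtain \<phi> :: "'a zorn \<Rightarrow> 'b" where bij: "bij \<phi>"
    and \<phi>: "\<And>x y. \<phi> (x + y) = \<phi> x + \<phi> y" "\<And>a x. \<phi> (zorn_scale a x) = scale a (\<phi> x)"
    "\<And>x y. \<phi> (zorn_mul x y) = mul (\<phi> x) (\<phi> y)" "\<phi> (1,1,0,0,0,0,0,0) = unit"
    by (rule zorn_isomorphism) blast
  define \<psi> where "\<psi> = inv_into UNIV \<phi>"
  have \<phi>\<psi>: "\<phi> (\<psi> x) = x" for x using bij by (simp add: \<psi>_def bij_is_surj surj_f_inv_f)
  have \<psi>\<phi>: "\<psi> (\<phi> s) = s" for s using bij by (simp add: \<psi>_def bij_is_inj)
  have bij\<psi>: "bij \<psi>" using bij by (simp add: \<psi>_def bij_imp_bij_inv)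
  have \<psi>: "\<psi> (x + y) = \<psi> x + \<psi> y" "\<psi> (scale c x) = zorn_scale c (\<psi> x)"
    "\<psi> (mul x y) = zorn_mul (\<psi> x) (\<psi> y)" "\<psi> unit = (1,1,0,0,0,0,0,0)" for x y c
    by (metis \<phi> \<phi>\<psi> \<psi>\<phi>)+
  define A where "A = zorn_cubic a b q"
  define A' where "A' = zorn_cubic_inv a b q"
  have AA': "A (A' s) = s" "A' (A s) = s" for s by (simp_all add: A_def A'_def zorn_cubic_inverses q)
  have "bij A" by (rule o_bij[of A']) (simp_all add: fun_eq_iff AA')
  define g where "g = \<phi> \<circ> A \<circ> \<psi>"
  have gG: "g \<in> carrier G"
    unfolding G_def
  proof (rule carrier_algebra_aut_groupI)
    show "bij g" unfolding g_def using bij bij\<psi> \<open>bij A\<close> by (intro bij_comp)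
  qed (simp_all add: g_def \<psi> A_def zorn_cubic_add zorn_cubic_scale zorn_cubic_mul[OF q] \<phi>
      del: zorn_cubic.simps, simp add: \<phi>)
  have no_root: "a + b \<noteq> 0" "a - b \<noteq> 2"
    using root[of 1] root[of "- 1"] by (auto simp: algebra_simps)
  have "\<not> conjugate_in G g (inv\<^bsub>G\<^esub> g)"
  proof
    assume "conjugate_in G g (inv\<^bsub>G\<^esub> g)"
    then obtain h where h: "h \<in> carrier G" "h \<otimes>\<^bsub>G\<^esub> g \<otimes>\<^bsub>G\<^esub> inv\<^bsub>G\<^esub> h = inv\<^bsub>G\<^esub> g"
      unfolding conjugate_in_def by blast
    interpret G: group G unfolding G_def by (rule group_algebra_aut_group)
    have mult: "x \<otimes>\<^bsub>G\<^esub> y = x \<circ> y" for x y by (simp add: G_def algebra_aut_group_def)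
    \<comment> \<open>Conjugacy is rewritten as \<open>g (h (g x)) = h x\<close>, which can be
      evaluated without a formula for inverses in \<open>G\<close>.\<close>
    have "h \<otimes>\<^bsub>G\<^esub> g = inv\<^bsub>G\<^esub> g \<otimes>\<^bsub>G\<^esub> h"
      using h gG by (metis G.inv_closed G.inv_solve_right G.m_closed)
    then have "g \<otimes>\<^bsub>G\<^esub> (h \<otimes>\<^bsub>G\<^esub> g) = h"
      using h gG by (simp add: G.m_assoc[symmetric])
    then have ghg: "g (h (g x)) = h x" for x by (simp add: mult fun_eq_iff)
    have hlin: "Vector_Spaces.linear scale scale h" and "bij h"
      and hhom: "\<And>x y. h (mul x y) = mul (h x) (h y)" "h unit = unit"
      using h(1) by (auto simp: G_def algebra_aut_group_def)
    interpret h: Vector_Spaces.linear scale scale h by (rule hlin)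
    define k where "k = (\<lambda>s. \<psi> (h (\<phi> s)))"
    interpret zorn_cubic_inverting a b q k
    proof
      show "inj k"
        using inj_compose[OF bij_is_inj[OF bij\<psi>] inj_compose[OF bij_is_inj[OF \<open>bij h\<close>] bij_is_inj[OF bij]]]
        by (simp add: k_def comp_def)
      show "k (zorn_cubic a b q s) = zorn_cubic_inv a b q (k s)" for s
      proof -
        have "\<psi> (g (h (g (\<phi> s)))) = A (k (A s))" by (simp add: g_def \<psi>\<phi> k_def)
        then have "A (k (A s)) = k s" by (simp add: ghg k_def)
        then have "k (A s) = A' (k s)" by (metis AA'(2))
        then show ?thesis by (simp add: A_def A'_def)
      qed
    qed (simp_all add: q no_root k_def \<phi> \<psi> h.add h.scale hhom)
    show False using ex_hankel hankel by blast
  qed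
  moreover have "semisimple scale g"
  proof -
    define bs where "bs = map \<phi> zorn_basis"
    have len: "length (zorn_basis :: 'a zorn list) = 8" by (simp add: zorn_basis_def)
    have \<phi>_sum: "\<phi> s = (\<Sum>i<8. scale (zorn_list s ! i) (bs ! i))" for s
    proof -
      have "\<phi> s = \<phi> (\<Sum>i<8. zorn_scale (zorn_list s ! i) (zorn_basis ! i))"
        by (simp flip: zorn_list_sum)
      also have "\<dots> = (\<Sum>i<8. scale (zorn_list s ! i) (\<phi> (zorn_basis ! i)))"
        by (simp only: sum_lessThan_8 \<phi>)
      finally show ?thesis by (simp add: bs_def len)
    qed
    have "x \<in> span (set bs)" for x
    proof -
      have "x = (\<Sum>i<8. scale (zorn_list (\<psi> x) ! i) (bs ! i))"
        using \<phi>_sum[of "\<psi> x"] by (simp add: \<phi>\<psi>)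
      also have "\<dots> \<in> span (set bs)"
        by (intro span_sum span_scale span_base) (simp add: bs_def len)
      finally show ?thesis .
    qed
    then have bs: "basis_list scale bs"
      by (intro basis_list_if_spanning) (auto simp: bs_def len dim_8)
    have mat: "endo_mat scale bs g = zorn_cubic_mat a b q"
    proof (rule eq_matI)
      fix i j assume "i < dim_row (zorn_cubic_mat a b q)" "j < dim_col (zorn_cubic_mat a b q)"
      then have ij: "i < 8" "j < 8" by (simp_all add: zorn_cubic_mat_def)
      have "g (bs ! j) = \<phi> (zorn_cubic a b q (zorn_basis ! j))"
        using ij by (simp add: bs_def len g_def \<psi>\<phi> A_def)
      then have "g (bs ! j) = (\<Sum>i<length bs. scale (zorn_list (zorn_cubic a b q (zorn_basis ! j)) ! i) (bs ! i))"
        by (simp add: \<phi>_sum bs_def len)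
      from representation_basis_list[OF bs _ this, of i] ij
      show "endo_mat scale bs g $$ (i, j) = zorn_cubic_mat a b q $$ (i, j)"
        by (simp add: endo_mat_def zorn_cubic_mat_def bs_def len)
    qed (simp_all add: endo_mat_def zorn_cubic_mat_def bs_def len)
    obtain r1 r2 r3 where vieta: "to_ac a = - (r1 + r2 + r3)"
      "to_ac b = r1 * r2 + r1 * r3 + r2 * r3" "r1 * r2 * r3 = 1"
      by (rule cubic_roots)
    have "r1 \<noteq> r2"
      using cubic_double_root[OF root char, of r1 r3] vieta by (auto simp: algebra_simps)
    moreover have "r1 \<noteq> r3"
      using cubic_double_root[OF root char, of r1 r2] vieta by (auto simp: algebra_simps)
    moreover have "r2 \<noteq> r3"
      using cubic_double_root[OF root char, of r2 r1] vieta by (auto simp: algebra_simps)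
    ultimately obtain D where "diagonal_mat D" "similar_mat (zorn_cubic_mat (to_ac a) (to_ac b) (to_ac q)) D"
      using zorn_cubic_mat_diagonalizable[OF _ vieta, of "to_ac q"] q by auto
    then show ?thesis
      unfolding semisimple_def using bs by (metis mat map_mat_zorn_cubic_mat)
  qed
  ultimately show ?thesis using gG by blast
qed

text \<open>The choice \<open>q = \<iota> p\<close> makes \<open>q\<close> times a nonzero Hankel
  determinant have valuation 1 modulo 3, so it cannot be - 1.\<close>

lemma (in discrete_valuation_residue) ex_semisimple_not_conjugate_inverse:
  fixes \<iota> :: "'r \<Rightarrow> 'k::field"
    and scale :: "'k \<Rightarrow> 'c::ab_group_add \<Rightarrow> 'c"
  assumes "split_octonion_algebra scale mul unit N"
    and root: "\<And>r. r ^ 3 + res a * r\<^sup>2 + res b * r - 1 \<noteq> 0"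
    and hom: "\<And>x y. \<iota> (x + y) = \<iota> x + \<iota> y" "\<And>x y. \<iota> (x * y) = \<iota> x * \<iota> y"
    and inj: "inj \<iota>"
    and fraction: "\<And>s. \<exists>x y. y \<noteq> 0 \<and> s * \<iota> y = \<iota> x"
    and char: "(2::'k) \<noteq> 0" "(3::'k) \<noteq> 0"
  shows "\<exists>g \<in> carrier (algebra_aut_group scale mul unit). semisimple scale g \<and>
    \<not> conjugate_in (algebra_aut_group scale mul unit) g (inv\<^bsub>algebra_aut_group scale mul unit\<^esub> g)"
proof (rule split_octonion_algebra.ex_semisimple_not_conjugate_inverse[OF assms(1) _ char])
  show "\<iota> p \<noteq> 0" using inj p_nonzero hom(1)[of 0 0] by (metis add_cancel_right_left injD)
  show "r ^ 3 + \<iota> a * r\<^sup>2 + \<iota> b * r - 1 \<noteq> 0" for r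
    by (rule fraction_no_root[OF root hom inj fraction])
  show "\<iota> p * hankel (\<iota> a) (\<iota> b) s0 s1 s2 \<noteq> - 1" for s0 s1 s2
    by (rule fraction_hankel_neq(1)[OF root hom inj fraction])
qed

theorem theorem6p10:
  fixes scale :: "rat \<Rightarrow> 'c::ab_group_add \<Rightarrow> 'c"
    and mul :: "'c \<Rightarrow> 'c \<Rightarrow> 'c" and unit :: 'c and N :: "'c \<Rightarrow> rat"
    and scale\<^sub>p :: "'p::prime_card padic \<Rightarrow> 'd::ab_group_add \<Rightarrow> 'd"
    and mul\<^sub>p :: "'d \<Rightarrow> 'd \<Rightarrow> 'd" and unit\<^sub>p :: 'd and N\<^sub>p :: "'d \<Rightarrow> 'p padic"
  shows
    "(split_octonion_algebra scale mul unit N \<longrightarrow>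
        (\<exists>g \<in> carrier (algebra_aut_group scale mul unit). semisimple scale g \<and>
           \<not> conjugate_in (algebra_aut_group scale mul unit)
               g (inv\<^bsub>algebra_aut_group scale mul unit\<^esub> g))) \<and>
     (split_octonion_algebra scale\<^sub>p mul\<^sub>p unit\<^sub>p N\<^sub>p \<longrightarrow>
        (\<exists>g \<in> carrier (algebra_aut_group scale\<^sub>p mul\<^sub>p unit\<^sub>p). semisimple scale\<^sub>p g \<and>
           \<not> conjugate_in (algebra_aut_group scale\<^sub>p mul\<^sub>p unit\<^sub>p)
               g (inv\<^bsub>algebra_aut_group scale\<^sub>p mul\<^sub>p unit\<^sub>p\<^esub> g)))"
proof (intro conjI impI)
  \<comment> \<open>One cubic without roots modulo \<open>CARD('p)\<close>, with coefficients lifted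
    to natural numbers, serves both fields; over the rationals \<open>CARD('p)\<close> is an
    auxiliary prime.\<close>
  obtain a' b' :: "'p mod_ring" where root': "\<And>r. r ^ 3 + a' * r\<^sup>2 + b' * r - 1 \<noteq> 0"
    using finite_field_cubic_without_root by blast
  obtain a b where ab: "a' = of_nat a" "b' = of_nat b" using surj_of_nat_mod_ring by metis
  have root: "r ^ 3 + of_int (int a) * r\<^sup>2 + of_int (int b) * r - 1 \<noteq> 0" for r :: "'p mod_ring"
    using root' ab by simp
  {
    assume "split_octonion_algebra scale mul unit N"
    then show "\<exists>g \<in> carrier (algebra_aut_group scale mul unit). semisimple scale g \<and>
        \<not> conjugate_in (algebra_aut_group scale mul unit) g (inv\<^bsub>algebra_aut_group scale mul unit\<^esub> g)"
    proof (rule discrete_valuation_residue.ex_semisimple_not_conjugate_inverse[where \<iota> = rat_of_int,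
          OF discrete_valuation_residue_int _ root])
      show "\<exists>x y. y \<noteq> 0 \<and> s * rat_of_int y = rat_of_int x" for s
      proof -
        obtain x y where "s = Rat.Fract x y" "y > 0" by (rule Rat_cases)
        then show ?thesis by (intro exI[of _ x] exI[of _ y]) (simp add: Fract_of_int_quotient)
      qed
    qed (simp_all add: inj_def)
  next
    assume "split_octonion_algebra scale\<^sub>p mul\<^sub>p unit\<^sub>p N\<^sub>p"
    moreover
    define \<iota> :: "'p padic_int \<Rightarrow> 'p padic" where "\<iota> = (\<lambda>x. Fract x 1)"
    have \<iota>_of_nat: "\<iota> (of_nat n) = of_nat n" for n by (simp add: \<iota>_def Fract_of_nat_eq)
    have inj: "inj \<iota>" by (auto simp: inj_def \<iota>_def eq_fract)
    have component: "of_int (padic_component (of_nat n :: 'p padic_int) 1) = (of_int (int n) :: 'p mod_ring)" for n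
      by (simp only: padic_component_of_nat power_one_right of_int_mod_CARD)
    ultimately show "\<exists>g \<in> carrier (algebra_aut_group scale\<^sub>p mul\<^sub>p unit\<^sub>p). semisimple scale\<^sub>p g \<and>
        \<not> conjugate_in (algebra_aut_group scale\<^sub>p mul\<^sub>p unit\<^sub>p) g (inv\<^bsub>algebra_aut_group scale\<^sub>p mul\<^sub>p unit\<^sub>p\<^esub> g)"
    proof (intro discrete_valuation_residue.ex_semisimple_not_conjugate_inverse[where \<iota> = \<iota>
          and a = "of_nat a" and b = "of_nat b", OF discrete_valuation_residue_padic_int])
      show "r ^ 3 + of_int (padic_component (of_nat a :: 'p padic_int) 1) * r\<^sup>2
          + of_int (padic_component (of_nat b :: 'p padic_int) 1) * r - 1 \<noteq> 0" for r :: "'p mod_ring"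
        unfolding component by (rule root)
      show "\<exists>x y. y \<noteq> 0 \<and> s * \<iota> y = \<iota> x" for s
      proof -
        obtain x y where "s = Fract x y" "y \<noteq> 0" by (rule Fract_cases)
        then show ?thesis by (intro exI[of _ x] exI[of _ y]) (simp add: \<iota>_def eq_fract)
      qed
      have "of_nat n \<noteq> (0 :: 'p padic)" if "n > 0" for n
        using that inj by (metis \<iota>_of_nat injD of_nat_0 of_nat_padic_int_eq_0_iff less_numeral_extra(3))
      from this[of 2] this[of 3] show "(2 :: 'p padic) \<noteq> 0" "(3 :: 'p padic) \<noteq> 0" by simp_all
    qed (simp_all add: \<iota>_def inj[unfolded \<iota>_def])
  }
qed

end
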